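(* Let $a_1,\dots,a_n$ be real numbers such that $\sum_{i=1}^{n} a_i^2 = 1$ and let $\epsilon_1,\dots,\epsilon_n$ be i.i.d. random variables with $\mathbb{P}(\epsilon_i=+1)=\mathbb{P}(\epsilon_i=-1)=\frac12$. Then $$\mathbb{P}\left(\left|\sum_{i=1}^n \epsilon_i a_i\right|\le 1\right)\ge 0.46.$$ *)

theory Defs
  imports "HOL-Probability.Probability"
begin

end

theory Submission
  imports Defs
begin

text \<open>Let \<open>S\<close> be the signed sum. Signs of the weights and their order do not matter, so let
\<open>a \<ge> b \<ge> \<dots> \<ge> 0\<close> be the weights. The proof is an induction on their number, and the sizes of \<open>a\<close> and \<open>b\<close>
decide between three methods.

\<^bold>\<open>Small weights\<close> (\<open>a \<le> 3/8\<close>, or \<open>a \<le> 14/25\<close> and \<open>b \<le> 7/25\<close>). Here \<open>S\<close> is close to a Gaussian on the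
Fourier side. A quartic polynomial in \<open>cos (7/5 x)\<close>, minus a small multiple of \<open>cosh (7/2 x)\<close> that
takes care of its further periods, lies below the indicator of \<open>[-1, 1]\<close> (\<open>bump_minorant\<close>). Its
expectation is a combination of the products \<open>\<Prod> cos (t a\<^sub>i)\<close> for four frequencies \<open>t\<close>, and small weights
keep these products near their Gaussian values (\<open>rad_ge_small_weights\<close>, \<open>rad_ge_one_large_weight\<close>).

\<^bold>\<open>A dominant weight\<close> (\<open>a \<ge> 353/500\<close>). Let \<open>Y\<close> be the sum of the other terms. As long as \<open>\<bar>Y\<bar> \<le> 1 + a\<close>, at least
one of the two signs of \<open>a\<close> brings the sum into \<open>[-1, 1]\<close>, so success has conditional probability at least
one half; the fourth moment of \<open>Y\<close> shows that \<open>\<bar>Y\<bar> > 1 + a\<close> is rare (\<open>rad_ge_dominant_weight\<close>).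

\<^bold>\<open>Everything in between.\<close> Fix a few large weights and let \<open>Y\<close> be the rest. Given \<open>Y = y\<close>, the conditional
probability \<open>N y\<close> of success is an explicit even step function. Whenever \<open>L - g y\<^sup>2 \<le> N y\<close> for all \<open>y\<close>,
taking expectations gives the bound \<open>L - g V\<close>, where \<open>V\<close> is the variance of \<open>Y\<close> (\<open>rad_ge_quadratic\<close>);
only the jumps of \<open>N\<close> need to be compared with the parabola. Two further ideas make this sharp enough.

\<^item> Small weights are combined into an artificial large one: add their terms until the partial sum first
leaves \<open>(-l, l)\<close>. The absolute value \<open>u\<close> of the stopped sum lies in \<open>[l, 2l)\<close>, and by symmetry \<open>u\<close> then acts as a
weight with a random sign (\<open>rad_block\<close>). With one large weight \<open>a\<close>, two such
blocks make the steps of \<open>N\<close> fine enough (\<open>rad_ge_three_blocks\<close>); with \<open>a\<close> and \<open>b\<close> large and \<open>a + b \<ge> 1\<close>, a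
single block does (\<open>rad_ge_long_pair\<close>).

\<^item> The induction hypothesis, rescaled, says that \<open>\<bar>Y\<bar>\<close> is at most its standard deviation with
probability at least 0.46. If \<open>N\<close> is large on that whole range, a parabola with a step on top of it
is the better minorant (\<open>rad_ge_quadratic_ind\<close>). This is used for \<open>a + b \<le> 1\<close> with \<open>a - b\<close> small
(\<open>rad_ge_short_pair\<close>) and in part of the case \<open>a + b \<ge> 1\<close> (\<open>rad_ge_long_pair\<close>).\<close>

section \<open>Signed sums as iterated averages\<close>

definition avg :: "real \<Rightarrow> (real \<Rightarrow> real) \<Rightarrow> real \<Rightarrow> real"
  where "avg a f x = (f (x + a) + f (x - a)) / 2"

lemma avg_commute: "avg a (avg b f) = avg b (avg a f)"
  by (simp add: avg_def fun_eq_iff add_divide_distrib, simp add: algebra_simps)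

text \<open>The expectation of \<open>f\<close> at the signed sum of the list. Recursion over the list makes conditioning on
some of the signs a matter of unfolding: the signs at the head of the list are averaged into \<open>f\<close>,
which leaves a function of the signed sum of the tail.\<close>
primrec rad :: "real list \<Rightarrow> (real \<Rightarrow> real) \<Rightarrow> real" where
  "rad [] f = f 0"
| "rad (a # as) f = rad as (avg a f)"

abbreviation ssq :: "real list \<Rightarrow> real"
  where "ssq as \<equiv> (\<Sum>a\<leftarrow>as. a\<^sup>2)"

lemma ssq_nonneg: "0 \<le> ssq as"
  by (induction as) auto

definition ind :: "real \<Rightarrow> real \<Rightarrow> real"
  where "ind r x = (if \<bar>x\<bar> \<le> r then 1 else 0)"

lemma ind_nonneg: "0 \<le> ind r x"
  by (simp add: ind_def)

lemma ind_1_eq_1: "- 1 \<le> x \<Longrightarrow> x \<le> 1 \<Longrightarrow> ind 1 x = 1"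
  by (simp add: ind_def)

definition even_fun :: "(real \<Rightarrow> real) \<Rightarrow> bool"
  where "even_fun f \<longleftrightarrow> (\<forall>x. f (- x) = f x)"

lemma even_funD: "even_fun f \<Longrightarrow> f \<bar>x\<bar> = f x"
  by (auto simp: even_fun_def abs_if)

lemma even_fun_ind: "even_fun (ind r)"
  by (simp add: even_fun_def ind_def)

lemma even_fun_avg: "even_fun f \<Longrightarrow> even_fun (avg a f)"
  unfolding even_fun_def avg_def
  by (metis add.commute minus_add_distrib minus_diff_eq uminus_add_conv_diff diff_minus_eq_add)

lemma rad_mono: "(\<And>x. f x \<le> g x) \<Longrightarrow> rad as f \<le> rad as g"
proof (induction as arbitrary: f g)
  case (Cons a as)
  show ?case
    unfolding rad.simps
    by (rule Cons.IH) (use Cons.prems in \<open>auto simp: avg_def intro!: divide_right_mono add_mono\<close>)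
qed simp

lemma rad_const [simp]: "rad as (\<lambda>x. c) = c"
proof (induction as)
  case (Cons a as)
  have "avg a (\<lambda>x. c) = (\<lambda>x. c)" by (simp add: avg_def fun_eq_iff)
  then show ?case using Cons by simp
qed simp

lemma rad_add: "rad as (\<lambda>x. f x + g x) = rad as f + rad as g"
proof (induction as arbitrary: f g)
  case (Cons a as)
  have "avg a (\<lambda>x. f x + g x) = (\<lambda>x. avg a f x + avg a g x)"
    by (simp add: avg_def fun_eq_iff field_simps)
  then show ?case using Cons.IH by simp
qed simp

lemma rad_scale: "rad as (\<lambda>x. c * f x) = c * rad as f"
proof (induction as arbitrary: f)
  case (Cons a as)
  have "avg a (\<lambda>x. c * f x) = (\<lambda>x. c * avg a f x)"
    by (simp add: avg_def fun_eq_iff field_simps)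
  then show ?case using Cons.IH by simp
qed simp

lemma rad_perm: "mset as = mset bs \<Longrightarrow> rad as f = rad bs f"
proof -
  assume m: "mset as = mset bs"
  have r: "rad cs f = fold avg cs f 0" for cs f
    by (induction cs arbitrary: f) simp_all
  \<comment> \<open>Averages over different weights commute, so folding them depends on the multiset only.\<close>
  have "fold avg as = fold avg bs"
    by (rule fold_multiset_equiv[OF _ m])
       (simp add: avg_def fun_eq_iff add_divide_distrib, simp add: algebra_simps)
  then show ?thesis by (simp add: r)
qed

lemma rad_abs: "rad (map abs as) f = rad as f"
proof -
  have "avg \<bar>a\<bar> f = avg a f" for a f
    by (auto simp: avg_def fun_eq_iff abs_if)
  then show ?thesis by (induction as arbitrary: f) simp_all
qed

lemma rad_reflect: "rad as (\<lambda>x. f (- x)) = rad as f"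
proof (induction as arbitrary: f)
  case (Cons a as)
  have "avg a (\<lambda>x. f (- x)) = (\<lambda>x. avg a f (- x))"
    by (simp add: avg_def fun_eq_iff algebra_simps)
  then show ?case using Cons.IH[of "avg a f"] by simp
qed simp

lemma rad_rescale: "rad (map ((*) k) as) f = rad as (\<lambda>x. f (k * x))"
proof (induction as arbitrary: f)
  case (Cons a as)
  have "(\<lambda>x. avg (k * a) f (k * x)) = avg a (\<lambda>x. f (k * x))"
    by (simp add: avg_def fun_eq_iff algebra_simps)
  then show ?case using Cons.IH by simp
qed simp

lemma rad_zero_weights: "ssq as = 0 \<Longrightarrow> rad as f = f 0"
proof (induction as arbitrary: f)
  case (Cons a as)
  have "a\<^sup>2 = 0" "ssq as = 0" using Cons.prems ssq_nonneg[of as] by (auto simp: add_nonneg_eq_0_iff)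
  moreover have "avg 0 f = f" by (simp add: avg_def fun_eq_iff)
  ultimately show ?case using Cons.IH by simp
qed simp

lemma rad_square: "rad as (\<lambda>x. x\<^sup>2) = ssq as"
proof (induction as)
  case (Cons a as)
  have "avg a (\<lambda>x. x\<^sup>2) = (\<lambda>x. x\<^sup>2 + a\<^sup>2)"
    by (simp add: avg_def fun_eq_iff power2_eq_square field_simps)
  then show ?case using Cons.IH by (simp add: rad_add)
qed simp

text \<open>Induction on the list: the new term contributes \<open>6 a\<^sup>2 V + a\<^sup>4\<close>, while \<open>3 (V + a\<^sup>2)\<^sup>2\<close> grows by
\<open>6 a\<^sup>2 V + 3 a\<^sup>4\<close>.\<close>
lemma rad_fourth_le: "rad as (\<lambda>x. x^4) \<le> 3 * (ssq as)\<^sup>2"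
proof (induction as)
  case (Cons a as)
  have "avg a (\<lambda>x. x^4) = (\<lambda>x. x^4 + (6 * a\<^sup>2 * x\<^sup>2 + a^4))"
    by (simp add: avg_def fun_eq_iff power2_eq_square power4_eq_xxxx field_simps)
  then have "rad (a # as) (\<lambda>x. x^4) = rad as (\<lambda>x. x^4) + (6 * a\<^sup>2 * ssq as + a^4)"
    by (simp add: rad_add rad_scale rad_square)
  moreover have "0 \<le> a^4" by simp
  ultimately show ?case
    using Cons.IH by (simp add: power2_eq_square power4_eq_xxxx algebra_simps)
qed simp

lemma rad_cos: "rad as (\<lambda>x. cos (t * x)) = (\<Prod>a\<leftarrow>as. cos (t * a))"
proof (induction as)
  case (Cons a as)
  have "avg a (\<lambda>x. cos (t * x)) = (\<lambda>x. cos (t * a) * cos (t * x))"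
    by (simp add: avg_def fun_eq_iff ring_distribs cos_add cos_diff)
  then show ?case using Cons.IH by (simp add: rad_scale)
qed simp

lemma rad_cosh: "rad as (\<lambda>x. cosh (t * x)) = (\<Prod>a\<leftarrow>as. cosh (t * a))"
proof (induction as)
  case (Cons a as)
  have "avg a (\<lambda>x. cosh (t * x)) = (\<lambda>x. cosh (t * a) * cosh (t * x))"
    by (simp add: avg_def fun_eq_iff ring_distribs cosh_add cosh_diff)
  then show ?case using Cons.IH by (simp add: rad_scale)
qed simp

section \<open>Quadratic minorants\<close>

text \<open>Chebyshev's inequality in the form used throughout: the expectation of a parabola depends only on
the variance.\<close>
lemma rad_ge_quadratic:
  assumes "\<And>x. L - g * x\<^sup>2 \<le> f x"
  shows "L - g * ssq as \<le> rad as f"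
proof -
  have "rad as (\<lambda>x. L + (- g) * x\<^sup>2) \<le> rad as f"
    by (rule rad_mono) (use assms in auto)
  then show ?thesis by (simp only: rad_add rad_scale rad_square rad_const)
qed

lemma rad_ge_quadratic_even:
  assumes "even_fun f" "\<And>y. 0 \<le> y \<Longrightarrow> L - g * y\<^sup>2 \<le> f y"
    and "0 \<le> g" "ssq as \<le> V" "c \<le> L - g * V"
  shows "c \<le> rad as f"
proof -
  have "L - g * y\<^sup>2 \<le> f y" for y
    using assms(2)[of "\<bar>y\<bar>"] even_funD[OF assms(1), of y] by simp
  then have "L - g * ssq as \<le> rad as f" by (rule rad_ge_quadratic)
  moreover have "g * ssq as \<le> g * V" using assms by (intro mult_left_mono)
  ultimately show ?thesis using assms(5) by linarith
qed

text \<open>A minorant with a step of height \<open>B\<close> on \<open>[-r, r]\<close> turns a bound \<open>p\<close> for the probability of that interval into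
an additional gain \<open>B p\<close>. The induction hypothesis supplies \<open>p = 0.46\<close> for \<open>r\<close> the standard
deviation.\<close>
lemma rad_ge_quadratic_ind:
  assumes "even_fun f" "\<And>y. 0 \<le> y \<Longrightarrow> A + B * ind r y - g * y\<^sup>2 \<le> f y"
    and "0 \<le> B" "p \<le> rad as (ind r)"
  shows "A + B * p - g * ssq as \<le> rad as f"
proof -
  have "A + (B * ind r y + (- g) * y\<^sup>2) \<le> f y" for y
    using assms(2)[of "\<bar>y\<bar>"] even_funD[OF assms(1), of y] even_funD[OF even_fun_ind, of r y] by simp
  then have "rad as (\<lambda>y. A + (B * ind r y + (- g) * y\<^sup>2)) \<le> rad as f" by (rule rad_mono)
  moreover have "B * p \<le> B * rad as (ind r)" using assms by (intro mult_left_mono)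
  ultimately show ?thesis unfolding rad_add rad_scale rad_square rad_const by linarith
qed

text \<open>A parabola \<open>L - g y\<^sup>2\<close> needs to be compared with a step function only at the left end \<open>t\<close> of each
step.\<close>
lemma quadratic_step:
  fixes t y g L K :: real
  assumes "L - g * t\<^sup>2 \<le> K" "0 \<le> t" "t \<le> y" "0 \<le> g"
  shows "L - g * y\<^sup>2 \<le> K"
proof -
  have "g * t\<^sup>2 \<le> g * y\<^sup>2" using assms by (intro mult_left_mono power_mono)
  then show ?thesis using assms(1) by linarith
qed

section \<open>Stopped partial sums\<close>

text \<open>The signed sum is symmetric, so for an even function a fixed shift \<open>u\<close> may be given a random sign.\<close>
lemma rad_shift_even:
  assumes "even_fun f"
  shows "rad as (\<lambda>x. f (u + x)) = rad as (avg u f)"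
proof -
  have e: "avg u f = (\<lambda>x. (1/2) * f (u + x) + (1/2) * f (u + - x))"
  proof
    fix x
    have "f (x - u) = f (u - x)" using assms unfolding even_fun_def by (metis minus_diff_eq)
    then show "avg u f x = (1/2) * f (u + x) + (1/2) * f (u + - x)"
      by (simp add: avg_def add.commute field_simps)
  qed
  show ?thesis
    unfolding e rad_add rad_scale
    using rad_reflect[of as "\<lambda>x. f (u + x)"] by simp
qed

text \<open>Reveal the terms one by one, \<open>x\<close> being the current partial sum. If the sum stays in \<open>(-l, l)\<close> until the end, the
bound on \<open>f\<close> applies. Otherwise it first leaves at some \<open>z\<close>, and \<open>rad_shift_even\<close> turns \<open>\<bar>z\<bar>\<close> into a weight.
The overshoot \<open>\<bar>z\<bar> - l\<close> is at most the last weight \<open>w\<close> used; hence the unused weights and the square of the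
overshoot together stay within the variance budget \<open>V\<close>. The parameters \<open>W\<close> and \<open>n\<close> record that the unused
weights form a part of the original list.\<close>
lemma rad_stop_at_level:
  assumes "even_fun f"
    and "\<And>y. \<bar>y\<bar> < l \<Longrightarrow> c \<le> f y"
    and "\<And>u rs. l \<le> u \<Longrightarrow> u < 2 * l \<Longrightarrow> set rs \<subseteq> W \<Longrightarrow> length rs \<le> n
      \<Longrightarrow> ssq rs + (u - l)\<^sup>2 \<le> V \<Longrightarrow> c \<le> rad rs (avg u f)"
  shows "(\<forall>w \<in> set ws. 0 \<le> w \<and> w < l) \<Longrightarrow> set ws \<subseteq> W \<Longrightarrow> length ws \<le> n
    \<Longrightarrow> ssq ws \<le> V \<Longrightarrow> \<bar>x\<bar> < l
    \<Longrightarrow> c \<le> rad ws (\<lambda>y. f (x + y))"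
proof (induction ws arbitrary: x)
  case Nil
  then show ?case using assms(2) by simp
next
  case (Cons w ws)
  have V: "ssq ws \<le> V" and W: "set ws \<subseteq> W" and n: "length ws \<le> n"
    and w: "0 \<le> w" "w < l" and ws: "\<forall>w \<in> set ws. 0 \<le> w \<and> w < l"
    using Cons.prems by (auto intro: order_trans[rotated])
  have step: "c \<le> rad ws (\<lambda>y. f (z + y))" if z: "\<bar>z\<bar> < l + w" for z
  proof (cases "\<bar>z\<bar> < l")
    case True
    then show ?thesis using Cons.IH ws V W n by blast
  next
    case False
    have "avg z f = avg \<bar>z\<bar> f" by (auto simp: avg_def fun_eq_iff abs_if)
    then have "rad ws (\<lambda>y. f (z + y)) = rad ws (avg \<bar>z\<bar> f)"
      using rad_shift_even[OF assms(1)] by simp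
    moreover have "(\<bar>z\<bar> - l)\<^sup>2 \<le> w\<^sup>2" using False z by (intro power_mono) auto
    then have "ssq ws + (\<bar>z\<bar> - l)\<^sup>2 \<le> V" using Cons.prems(4) by simp
    ultimately show ?thesis using assms(3)[of "\<bar>z\<bar>" ws] False z w W n by simp
  qed
  \<comment> \<open>Conditioning on the sign of the first weight.\<close>
  have e: "avg w (\<lambda>y. f (x + y)) = (\<lambda>y. (1/2) * f ((x + w) + y) + (1/2) * f ((x - w) + y))"
    by (simp add: avg_def fun_eq_iff algebra_simps)
  have "c \<le> rad ws (\<lambda>y. f ((x + w) + y))" "c \<le> rad ws (\<lambda>y. f ((x - w) + y))"
    using step[of "x + w"] step[of "x - w"] w Cons.prems(5) by auto
  then show ?case unfolding rad.simps e rad_add rad_scale by linarith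
qed

lemma rad_move_front:
  assumes "w \<in> set ws"
  obtains rs where "mset ws = mset (w # rs)" "set rs \<subseteq> set ws" "length rs \<le> length ws"
    "ssq ws = w\<^sup>2 + ssq rs"
proof
  show m: "mset ws = mset (w # remove1 w ws)" using assms by simp
  show "set (remove1 w ws) \<subseteq> set ws" by (rule set_remove1_subset)
  show "length (remove1 w ws) \<le> length ws" by (simp add: length_remove1)
  show "ssq ws = w\<^sup>2 + ssq (remove1 w ws)"
    using arg_cong[OF m, of "\<lambda>M. \<Sum>a\<in>#M. a\<^sup>2"] by (simp flip: sum_mset_sum_list)
qed

text \<open>The weights of a list may be replaced by a single weight \<open>u\<close> in \<open>[l, 2 l]\<close> and a remaining list whose variance
has dropped at least by \<open>(u - l)\<^sup>2\<close>. A weight that is itself at least \<open>l\<close> can serve as \<open>u\<close>; if there is none, \<open>u\<close> is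
the stopped partial sum of \<open>rad_stop_at_level\<close>.\<close>
lemma rad_block:
  assumes f: "even_fun f" and l: "0 < l"
    and ws: "\<And>w. w \<in> set ws \<Longrightarrow> 0 \<le> w \<and> w \<le> 2 * l"
    and small: "\<And>y. \<bar>y\<bar> < l \<Longrightarrow> c \<le> f y"
    and block: "\<And>u rs. l \<le> u \<Longrightarrow> u \<le> 2 * l \<Longrightarrow> set rs \<subseteq> set ws
      \<Longrightarrow> length rs \<le> length ws \<Longrightarrow> ssq rs + (u - l)\<^sup>2 \<le> ssq ws
      \<Longrightarrow> c \<le> rad rs (avg u f)"
  shows "c \<le> rad ws f"
proof (cases "\<exists>w \<in> set ws. l \<le> w")
  case True
  then obtain w where w: "w \<in> set ws" "l \<le> w" by blast
  obtain rs where rs: "mset ws = mset (w # rs)" "set rs \<subseteq> set ws" "length rs \<le> length ws"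
    "ssq ws = w\<^sup>2 + ssq rs"
    by (rule rad_move_front[OF w(1)])
  have "(w - l)\<^sup>2 \<le> w\<^sup>2" using w l by (intro power_mono) auto
  then have "c \<le> rad rs (avg w f)"
    using w ws[OF w(1)] rs by (intro block) auto
  then show ?thesis using rad_perm[OF rs(1)] by simp
next
  case False
  then have "\<forall>w \<in> set ws. 0 \<le> w \<and> w < l" using ws by force
  then show ?thesis
    using rad_stop_at_level[of f l c "set ws" "length ws" "ssq ws" ws 0] f l small block by simp
qed

section \<open>Elementary bounds for exp, cos and cosh\<close>

lemma exp_ge_taylor:
  assumes "even n"
  shows "(\<Sum>m<n. x ^ m / fact m) \<le> exp (x::real)"
proof -
  obtain t where "exp x = (\<Sum>m<n. x ^ m / fact m) + exp t / fact n * x ^ n"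
    using Maclaurin_exp_le[of x n] by blast
  moreover have "0 \<le> exp t / fact n * x ^ n" using assms by (simp add: zero_le_even_power)
  ultimately show ?thesis by linarith
qed

lemma exp_le_taylor:
  assumes "odd n" "x \<le> 0"
  shows "exp (x::real) \<le> (\<Sum>m<n. x ^ m / fact m)"
proof -
  obtain t where "exp x = (\<Sum>m<n. x ^ m / fact m) + exp t / fact n * x ^ n"
    using Maclaurin_exp_le[of x n] by blast
  moreover have "exp t / fact n * x ^ n \<le> 0" using assms
    by (intro mult_nonneg_nonpos) (auto simp: power_le_zero_eq odd_pos)
  ultimately show ?thesis by linarith
qed

lemma exp_half_ge: "1648/1000 \<le> exp (1/2 :: real)"
  using exp_ge_taylor[of 6 "1/2"] by (simp add: lessThan_nat_numeral fact_numeral power_divide)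

text \<open>By convexity \<open>exp (- k x)\<close> stays below the chord \<open>1 - h x\<close> up to some point beyond 0 when \<open>h < k\<close>; the
quadratic Taylor polynomial shows that any \<open>x\<close> as in the last assumption is not past that point.\<close>
lemma exp_neg_quadratic_le:
  fixes x :: real
  assumes "0 \<le> k" "0 \<le> x" "k\<^sup>2 / 2 * x \<le> k - h"
  shows "exp (- k * x) \<le> 1 - h * x"
proof -
  have "exp (- k * x) \<le> 1 - k * x + (k * x)\<^sup>2 / 2"
    using exp_le_taylor[of 3 "- k * x"] assms(1,2) by (simp add: lessThan_nat_numeral fact_numeral)
  also have "(k * x)\<^sup>2 / 2 = k\<^sup>2 / 2 * x * x" by (simp add: power2_eq_square)
  also have "\<dots> \<le> (k - h) * x" using assms by (intro mult_right_mono) auto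
  finally show ?thesis by (simp add: algebra_simps)
qed

text \<open>Numerical upper bounds for \<open>exp\<close> are reduced to powers of one rational below \<open>exp (1/2)\<close>.\<close>
lemma exp_neg_le:
  fixes x :: real
  assumes "real n / 2 \<le> x" "1 \<le> c * (1648/1000) ^ n" "0 < c"
  shows "exp (- x) \<le> c"
proof -
  have "(1648/1000) ^ n \<le> exp (1/2 :: real) ^ n" by (intro power_mono exp_half_ge) auto
  also have "\<dots> \<le> exp x" using assms(1) by (simp flip: exp_of_nat_mult)
  finally have "1 \<le> c * exp x"
    using assms mult_left_mono[of "(1648/1000) ^ n" "exp x" c] by linarith
  then show ?thesis by (simp add: exp_minus field_simps)
qed

lemma cos_taylor: "\<bar>cos x - (\<Sum>m<n. cos_coeff m * x ^ m)\<bar> \<le> \<bar>x\<bar> ^ n / fact n"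
proof -
  obtain t where "cos x = (\<Sum>m<n. cos_coeff m * x ^ m) + (cos (t + 1/2 * real n * pi) / fact n) * x ^ n"
    using Maclaurin_cos_expansion[of x n] by blast
  moreover have "\<bar>(cos (t + 1/2 * real n * pi) / fact n) * x ^ n\<bar> \<le> \<bar>x\<bar> ^ n / fact n"
    using abs_cos_le_one[of "t + 1/2 * real n * pi"]
    by (simp add: abs_mult power_abs divide_right_mono mult_left_le_one_le)
  ultimately show ?thesis by linarith
qed

lemma cos_ge2: "1 - x\<^sup>2 / 2 \<le> cos (x::real)"
  using cos_taylor[of x 2] by (simp add: cos_coeff_def lessThan_nat_numeral fact_numeral)

lemma cos_le4: "cos (x::real) \<le> 1 - x\<^sup>2 / 2 + x^4 / 24"
proof -
  have "(\<Sum>m<4. cos_coeff m * x ^ m) = 1 - x\<^sup>2 / 2"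
    by (simp add: cos_coeff_def lessThan_nat_numeral fact_numeral)
  moreover have "\<bar>x\<bar> ^ 4 / fact 4 = x ^ 4 / 24" by (simp add: fact_numeral)
  ultimately show ?thesis using cos_taylor[of x 4] by linarith
qed

lemma cos_ge6: "1 - x\<^sup>2 / 2 + x^4 / 24 - x^6 / 720 \<le> cos (x::real)"
proof -
  have "(\<Sum>m<6. cos_coeff m * x ^ m) = 1 - x\<^sup>2 / 2 + x^4 / 24"
    by (simp add: cos_coeff_def lessThan_nat_numeral fact_numeral)
  moreover have "\<bar>x\<bar> ^ 6 / fact 6 = x ^ 6 / 720" by (simp add: fact_numeral)
  ultimately show ?thesis using cos_taylor[of x 6] by linarith
qed

lemma cos_le8: "cos (x::real) \<le> 1 - x\<^sup>2 / 2 + x^4 / 24 - x^6 / 720 + x^8 / 40320"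
proof -
  have "(\<Sum>m<8. cos_coeff m * x ^ m) = 1 - x\<^sup>2 / 2 + x^4 / 24 - x^6 / 720"
    by (simp add: cos_coeff_def lessThan_nat_numeral fact_numeral)
  moreover have "\<bar>x\<bar> ^ 8 / fact 8 = x ^ 8 / 40320" by (simp add: fact_numeral)
  ultimately show ?thesis using cos_taylor[of x 8] by linarith
qed

text \<open>The quotient of the two sides is decreasing on the positive half-line because \<open>sinh y \<le> y cosh y\<close>.\<close>
lemma cosh_le_exp: "cosh x \<le> exp (x\<^sup>2 / 2)" for x :: real
proof -
  have s: "sinh y \<le> y * cosh y" if "0 \<le> y" for y :: real
  proof -
    have "0 * cosh 0 - sinh 0 \<le> y * cosh y - sinh y"
      by (rule DERIV_nonneg_imp_nondecreasing[OF that])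
         (auto intro!: exI derivative_eq_intros)
    then show ?thesis by simp
  qed
  have m: "cosh y * exp (- (y\<^sup>2 / 2)) \<le> cosh 0 * exp (- (0\<^sup>2 / 2))" if "0 \<le> y" for y :: real
  proof (rule DERIV_nonpos_imp_nonincreasing[OF that])
    fix z :: real assume "0 \<le> z"
    show "\<exists>D. ((\<lambda>z. cosh z * exp (- (z\<^sup>2 / 2))) has_real_derivative D) (at z) \<and> D \<le> 0"
    proof (intro exI conjI)
      show "((\<lambda>z. cosh z * exp (- (z\<^sup>2 / 2))) has_real_derivative
          (sinh z - z * cosh z) * exp (- (z\<^sup>2 / 2))) (at z)"
        by (auto intro!: derivative_eq_intros simp: algebra_simps)
      show "(sinh z - z * cosh z) * exp (- (z\<^sup>2 / 2)) \<le> 0"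
        using s[OF \<open>0 \<le> z\<close>] by (intro mult_nonpos_nonneg) auto
    qed
  qed
  have "cosh \<bar>x\<bar> * exp (- (\<bar>x\<bar>\<^sup>2 / 2)) \<le> 1" using m[of "\<bar>x\<bar>"] by simp
  then show ?thesis by (simp add: exp_minus field_simps)
qed

text \<open>Up to \<open>pi / 2\<close> the bound holds with the Gaussian exponent \<open>1/2\<close>. Beyond, \<open>\<bar>cos u\<bar>\<close> increases and the right-hand
side decreases in \<open>\<bar>u\<bar>\<close>, so the end point \<open>b\<close> of the range is the worst case.\<close>
lemma abs_cos_le_exp:
  assumes "0 \<le> m" "m \<le> 1/2" "\<bar>u\<bar> \<le> b" "pi / 2 \<le> b" "b \<le> pi" "- cos b \<le> exp (- m * b\<^sup>2)"
  shows "\<bar>cos u\<bar> \<le> exp (- m * u\<^sup>2)"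
proof (cases "\<bar>u\<bar> \<le> pi / 2")
  case True
  define s where "s = u\<^sup>2 / 2"
  have "\<bar>u\<bar> < 2" using True pi_less_4 by linarith
  then have "u\<^sup>2 < 2\<^sup>2" by (metis abs_ge_zero power2_abs power_strict_mono pos2)
  then have s: "0 \<le> s" "s \<le> 2" by (auto simp: s_def)
  have "cos u \<le> 1 - s + s\<^sup>2 / 6" using cos_le4[of u] by (simp add: s_def power2_eq_square power4_eq_xxxx)
  also have "\<dots> \<le> 1 - s + s\<^sup>2 / 2 - s^3 / 6"
  proof -
    have "0 \<le> s\<^sup>2 * (2 - s)" using s by simp
    then show ?thesis by (simp add: power2_eq_square power3_eq_cube algebra_simps)
  qed
  also have "\<dots> \<le> exp (- s)"
    using exp_ge_taylor[of 4 "- s"] by (simp add: lessThan_nat_numeral fact_numeral)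
  also have "\<dots> \<le> exp (- m * u\<^sup>2)"
    using mult_right_mono[OF assms(2), of "u\<^sup>2"] by (simp add: s_def)
  finally have "cos u \<le> exp (- m * u\<^sup>2)" .
  moreover have "0 \<le> cos u" using True by (intro cos_ge_zero) auto
  ultimately show ?thesis by simp
next
  case False
  have "cos b \<le> cos \<bar>u\<bar>" using assms False by (intro cos_monotone_0_pi_le) auto
  moreover have "cos \<bar>u\<bar> \<le> 0"
    using cos_monotone_0_pi_le[of "pi/2" "\<bar>u\<bar>"] False assms by simp
  moreover have "exp (- m * b\<^sup>2) \<le> exp (- m * u\<^sup>2)"
    using assms power_mono[of "\<bar>u\<bar>" b 2] mult_left_mono[of "u\<^sup>2" "b\<^sup>2" m] by simp
  ultimately have "- cos u \<le> exp (- m * u\<^sup>2)" "cos u \<le> 0"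
    using assms(6) unfolding cos_abs_real by linarith+
  then show ?thesis by simp
qed

lemma cos_nonneg_small: "0 \<le> cos u" if "\<bar>u\<bar> \<le> 157/100" for u :: real
  using that pi_approx by (intro cos_ge_zero) auto

text \<open>Here \<open>49/50\<close> is the quadratic coefficient of \<open>cos (7/5 a)\<close>, and \<open>k\<close> has to be slightly larger because \<open>exp\<close>
lies above its tangent at 0.\<close>
lemma cos_7_5_ge:
  fixes a k X :: real
  assumes "0 \<le> k" "k\<^sup>2 / 2 * X \<le> k - 49/50" "a\<^sup>2 \<le> X"
  shows "exp (- k * a\<^sup>2) \<le> cos (7/5 * a)"
proof -
  have "k\<^sup>2 / 2 * a\<^sup>2 \<le> k\<^sup>2 / 2 * X" using assms by (intro mult_left_mono) auto
  then have "exp (- k * a\<^sup>2) \<le> 1 - 49/50 * a\<^sup>2" using assms by (intro exp_neg_quadratic_le) auto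
  also have "\<dots> \<le> cos (7/5 * a)"
    using cos_ge2[of "7/5 * a"] by (simp add: power2_eq_square field_simps)
  finally show ?thesis .
qed

text \<open>Signed sums are sub-Gaussian.\<close>
lemma rad_cosh_le: "rad as (\<lambda>x. cosh (t * x)) \<le> exp (t\<^sup>2 / 2 * ssq as)"
proof -
  have "(\<Prod>a\<leftarrow>as. cosh (t * a)) \<le> exp (t\<^sup>2 / 2 * ssq as)"
  proof (induction as)
    case (Cons a as)
    have "cosh (t * a) * (\<Prod>a\<leftarrow>as. cosh (t * a)) \<le> exp ((t * a)\<^sup>2 / 2) * exp (t\<^sup>2 / 2 * ssq as)"
      using Cons cosh_le_exp[of "t * a"] by (intro mult_mono) (auto intro!: prod_list_nonneg)
    then show ?case by (simp add: power_mult_distrib algebra_simps flip: exp_add)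
  qed simp
  then show ?thesis by (simp add: rad_cosh)
qed

section \<open>Products of cosines\<close>

lemma prod_cos_ge:
  assumes "\<And>a. a \<in> set as \<Longrightarrow> exp (- k * a\<^sup>2) \<le> cos (t * a)"
  shows "exp (- k * ssq as) \<le> (\<Prod>a\<leftarrow>as. cos (t * a))"
  using assms
proof (induction as)
  case (Cons a as)
  have "exp (- k * a\<^sup>2) * exp (- k * ssq as) \<le> cos (t * a) * (\<Prod>a\<leftarrow>as. cos (t * a))"
    using Cons by (intro mult_mono) (auto intro: order_trans[OF exp_ge_zero])
  then show ?case by (simp add: ring_distribs flip: exp_add)
qed simp

lemma abs_prod_cos_le:
  assumes "\<And>a. a \<in> set as \<Longrightarrow> \<bar>cos (t * a)\<bar> \<le> exp (- k * a\<^sup>2)"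
  shows "\<bar>\<Prod>a\<leftarrow>as. cos (t * a)\<bar> \<le> exp (- k * ssq as)"
  using assms
proof (induction as)
  case (Cons a as)
  have "\<bar>cos (t * a)\<bar> * \<bar>\<Prod>a\<leftarrow>as. cos (t * a)\<bar> \<le> exp (- k * a\<^sup>2) * exp (- k * ssq as)"
    using Cons by (intro mult_mono) auto
  then show ?case by (simp add: ring_distribs abs_mult flip: exp_add)
qed simp

section \<open>A trigonometric minorant of the indicator\<close>

text \<open>As a function of \<open>c = cos (7/5 x)\<close>. The simple root \<open>17/100\<close> lies just above \<open>cos (7/5)\<close>, the value of \<open>c\<close> at \<open>\<bar>x\<bar> = 1\<close>;
the double root keeps the polynomial nonpositive, but not far below zero, for smaller \<open>c\<close>; the last
factor makes it flatten out just below 1 around \<open>c = 9/10\<close>.\<close>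
definition bump :: "real \<Rightarrow> real"
  where "bump c = 31/25 * (c - 17/100) * (c + 39/50)\<^sup>2 * (129/100 - c)"

lemma bump_nonpos: "bump c \<le> 0" if "c \<le> 17/100"
proof -
  have "bump c = (31/25 * (c + 39/50)\<^sup>2) * ((c - 17/100) * (129/100 - c))"
    unfolding bump_def by algebra
  also have "\<dots> \<le> 0" using that
    by (intro mult_nonneg_nonpos mult_nonpos_nonneg[of "c - 17/100"]) auto
  finally show ?thesis .
qed

text \<open>For \<open>c \<ge> 0\<close> the difference is a square around the near-touching point \<open>c = 9/10\<close> times a positive quadratic,
plus a remainder with positive coefficients.\<close>
lemma bump_le_1: "bump c \<le> 1" if "\<bar>c\<bar> \<le> 1"
proof (cases "0 \<le> c")
  case True
  have "1 - bump c = (c - 9/10)\<^sup>2 * (31/25 * c\<^sup>2 + 589/250 * c + 1438524/1000000)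
      + 374976/100000000 * c + (1 + 103402143/625000000 - 81/100 * (1438524/1000000))"
    by (simp add: bump_def power2_eq_square field_simps)
  also have "0 \<le> \<dots>" using True by (intro add_nonneg_nonneg mult_nonneg_nonneg) auto
  finally show ?thesis by simp
next
  case False
  then show ?thesis using bump_nonpos[of c] by linarith
qed

text \<open>The Fourier coefficients of the bump. The first two frequencies have positive coefficients, so
lower bounds for their cosine products suffice; the other two enter with small negative ones.\<close>
lemma bump_cos:
  "bump (cos u) = 167809107/625000000 + 3651459/6250000 * cos u + 139469/500000 * cos (2 * u)
    - 31/1000 * cos (3 * u) - 31/200 * cos (4 * u)"
proof -
  have "cos (4 * u) = 2 * (2 * (cos u)\<^sup>2 - 1)\<^sup>2 - 1"
    using cos_double_cos[of "2 * u"] cos_double_cos[of u] by simp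
  then show ?thesis
    unfolding bump_def cos_double_cos cos_treble_cos
    by (simp add: power2_eq_square power3_eq_cube field_simps)
qed

text \<open>The next window in which \<open>cos (7/5 x)\<close> exceeds its value at 1 begins at \<open>10/7 pi - 1\<close>, which is slightly
more than \<open>348/100\<close>.\<close>
lemma cos_le_between_windows:
  fixes x :: real
  assumes "1 < \<bar>x\<bar>" "\<bar>x\<bar> < 348/100"
  shows "cos (7/5 * x) \<le> 17/100"
proof -
  have c1: "cos (7/5) \<le> (17/100 :: real)"
    using cos_le8[of "7/5"] by (simp add: power_divide)
  have "cos (7/5 * \<bar>x\<bar>) \<le> cos (7/5)"
  proof (cases "7/5 * \<bar>x\<bar> \<le> pi")
    case True
    then show ?thesis using assms by (intro cos_monotone_0_pi_le) auto
  next
    case False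
    have "cos (7/5 * \<bar>x\<bar>) = cos (2 * pi - 7/5 * \<bar>x\<bar>)" by (simp add: cos_diff)
    also have "\<dots> \<le> cos (7/5)"
      using False assms pi_approx by (intro cos_monotone_0_pi_le) auto
    finally show ?thesis .
  qed
  moreover have "cos (7/5 * \<bar>x\<bar>) = cos (7/5 * x)" by (simp add: abs_if)
  ultimately show ?thesis using c1 by linarith
qed

text \<open>On \<open>[-1, 1]\<close> the bump is at most 1, and up to the next window it is at most 0. From there on
the \<open>cosh\<close> term exceeds 1, since \<open>609/50 = 7/2 * 348/100\<close>. The rate \<open>7/2\<close> is close to the optimal choice of \<open>t\<close> in the cost
\<open>2 exp (t\<^sup>2 / 2 - 348/100 t)\<close> of this correction.\<close>
lemma bump_minorant: "bump (cos (7/5 * x)) - 2 * exp (- (609/50)) * cosh (7/2 * x) \<le> ind 1 x"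
proof -
  have p: "0 \<le> 2 * exp (- (609/50)) * cosh (7/2 * x)" by simp
  consider "\<bar>x\<bar> \<le> 1" | "1 < \<bar>x\<bar>" "\<bar>x\<bar> < 348/100" | "348/100 \<le> \<bar>x\<bar>" by linarith
  then show ?thesis
  proof cases
    case 1
    then have "ind 1 x = 1" by (simp add: ind_def)
    then show ?thesis using p bump_le_1[OF abs_cos_le_one, of "7/5 * x"] by linarith
  next
    case 2
    have "0 \<le> ind 1 x" by (simp add: ind_def)
    then show ?thesis using p bump_nonpos[OF cos_le_between_windows[OF 2]] by linarith
  next
    case 3
    have "exp (609/50) \<le> exp (7/2 * \<bar>x\<bar>)" using 3 by simp
    also have "\<dots> \<le> 2 * cosh (7/2 * \<bar>x\<bar>)" by (simp add: cosh_field_def)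
    also have "cosh (7/2 * \<bar>x\<bar>) = cosh (7/2 * x)" by (simp add: abs_if)
    finally have "1 \<le> 2 * exp (- (609/50)) * cosh (7/2 * x)"
      by (simp add: exp_minus field_simps)
    moreover have "0 \<le> ind 1 x" by (simp add: ind_def)
    ultimately show ?thesis using bump_le_1[OF abs_cos_le_one, of "7/5 * x"] by linarith
  qed
qed

text \<open>Taking expectations in \<open>bump_minorant\<close>: the bump contributes
\<open>0.268 + 0.584 * 0.345 - 0.031 * 0.01 - 0.155 * 0.012\<close>, and the correction costs at most \<open>1/200\<close>.\<close>
lemma rad_ge_of_frequencies:
  assumes "ssq as = 1"
    and "345/1000 \<le> (\<Prod>a\<leftarrow>as. cos (7/5 * a))"
    and "0 \<le> (\<Prod>a\<leftarrow>as. cos (14/5 * a))"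
    and "(\<Prod>a\<leftarrow>as. cos (21/5 * a)) \<le> 1/100"
    and "(\<Prod>a\<leftarrow>as. cos (28/5 * a)) \<le> 12/1000"
  shows "0.46 \<le> rad as (ind 1)"
proof -
  have e: "(\<lambda>x. bump (cos (7/5 * x)) - 2 * exp (- (609/50)) * cosh (7/2 * x)) =
    (\<lambda>x. 167809107/625000000 + (3651459/6250000 * cos (7/5 * x) + (139469/500000 * cos (14/5 * x)
    + ((- 31/1000) * cos (21/5 * x) + ((- 31/200) * cos (28/5 * x)
    + (- 2 * exp (- (609/50))) * cosh (7/2 * x))))))"
    by (simp add: fun_eq_iff bump_cos)
  \<comment> \<open>The correction costs \<open>2 exp (49/8 - 609/50) \<le> 2 exp (- 6)\<close>.\<close>
  have "(1648/1000) ^ 12 \<le> exp (1/2 :: real) ^ 12" by (intro power_mono exp_half_ge) auto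
  then have "400 \<le> exp (6 :: real)" by (simp add: power_divide flip: exp_of_nat_mult)
  also have "\<dots> \<le> exp (609/50 - 49/8)" by simp
  finally have "400 * exp (- (609/50 - 49/8)) \<le> (1::real)"
    unfolding exp_minus by (simp add: field_simps)
  moreover have "exp (- (609/50 - 49/8)) = exp (- (609/50)) * exp (49/8 :: real)"
    by (simp flip: exp_add)
  ultimately have t: "2 * exp (- (609/50)) * exp (49/8) \<le> (1/200 :: real)" by linarith
  have "rad as (\<lambda>x. cosh (7/2 * x)) \<le> exp (49/8)"
    using rad_cosh_le[of as "7/2"] assms(1) by (simp add: power2_eq_square)
  then have "2 * exp (- (609/50)) * rad as (\<lambda>x. cosh (7/2 * x)) \<le> 2 * exp (- (609/50)) * exp (49/8)"
    by (intro mult_left_mono) auto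
  then have "2 * exp (- (609/50)) * rad as (\<lambda>x. cosh (7/2 * x)) \<le> 1/200" using t by linarith
  moreover have "rad as (\<lambda>x. bump (cos (7/5 * x)) - 2 * exp (- (609/50)) * cosh (7/2 * x)) \<le> rad as (ind 1)"
    by (intro rad_mono bump_minorant)
  ultimately show ?thesis
    using assms(2-) unfolding e rad_add rad_scale rad_cos rad_const by simp
qed

section \<open>Small weights\<close>

text \<open>All four cosine products are compared with Gaussians. The bound \<open>3/8\<close> is what the first product can
tolerate: there \<open>cos (7/5 a) \<ge> exp (- 1.06 a\<^sup>2)\<close>, and \<open>exp (- 1.06)\<close> is just above \<open>345/1000\<close>.\<close>
lemma rad_ge_small_weights:
  assumes "ssq as = 1" and as: "\<And>a. a \<in> set as \<Longrightarrow> 0 \<le> a \<and> a \<le> 3/8"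
  shows "0.46 \<le> rad as (ind 1)"
proof (rule rad_ge_of_frequencies[OF assms(1)])
  have "exp (- (106/100) * ssq as) \<le> (\<Prod>a\<leftarrow>as. cos (7/5 * a))"
  proof (rule prod_cos_ge)
    fix a assume "a \<in> set as"
    then have "a\<^sup>2 \<le> (3/8)\<^sup>2" using as by (intro power_mono) auto
    then show "exp (- (106/100) * a\<^sup>2) \<le> cos (7/5 * a)"
      by (rule cos_7_5_ge[rotated -1]) (simp_all add: power2_eq_square)
  qed
  moreover have "345/1000 \<le> exp (- (106/100) :: real)"
    using exp_ge_taylor[of 8 "- (106/100)"] by (simp add: lessThan_nat_numeral fact_numeral power_divide)
  ultimately show "345/1000 \<le> (\<Prod>a\<leftarrow>as. cos (7/5 * a))" using assms(1) by simp
next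
  have "0 \<le> cos (14/5 * a)" if "a \<in> set as" for a
    using as[OF that] by (intro cos_nonneg_small) auto
  then show "0 \<le> (\<Prod>a\<leftarrow>as. cos (14/5 * a))"
    by (intro prod_list_nonneg) auto
next
  have "\<bar>\<Prod>a\<leftarrow>as. cos (21/5 * a)\<bar> \<le> exp (- (3/10 * (21/5)\<^sup>2) * ssq as)"
  proof (rule abs_prod_cos_le)
    fix a assume "a \<in> set as"
    \<comment> \<open>The angles are at most \<open>21/5 * 3/8 < 8/5\<close>, barely beyond \<open>pi / 2\<close>.\<close>
    have "- cos (8/5) \<le> exp (- (3/10) * (8/5)\<^sup>2 :: real)"
      using cos_ge2[of "8/5"] exp_ge_taylor[of 4 "- (3/10) * (8/5)\<^sup>2"]
      by (simp add: lessThan_nat_numeral fact_numeral power_divide)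
    then have "\<bar>cos (21/5 * a)\<bar> \<le> exp (- (3/10) * (21/5 * a)\<^sup>2)"
      using as[OF \<open>a \<in> set as\<close>] pi_approx by (intro abs_cos_le_exp[where b = "8/5"]) auto
    then show "\<bar>cos (21/5 * a)\<bar> \<le> exp (- (3/10 * (21/5)\<^sup>2) * a\<^sup>2)"
      by (simp only: power_mult_distrib mult.assoc mult_minus_left)
  qed
  moreover have "exp (- (3/10 * (21/5)\<^sup>2) :: real) \<le> 1/100"
    by (rule exp_neg_le[of 10]) (simp_all add: power2_eq_square power_divide)
  ultimately show "(\<Prod>a\<leftarrow>as. cos (21/5 * a)) \<le> 1/100" using assms(1) by simp
next
  have "\<bar>\<Prod>a\<leftarrow>as. cos (28/5 * a)\<bar> \<le> exp (- (145/1000 * (28/5)\<^sup>2) * ssq as)"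
  proof (rule abs_prod_cos_le)
    fix a assume "a \<in> set as"
    \<comment> \<open>The angles are at most \<open>28/5 * 3/8 = 21/10\<close>.\<close>
    have "- cos (21/10) \<le> exp (- (145/1000) * (21/10)\<^sup>2 :: real)"
      using cos_ge6[of "21/10"] exp_ge_taylor[of 4 "- (145/1000) * (21/10)\<^sup>2"]
      by (simp add: lessThan_nat_numeral fact_numeral power_divide)
    then have "\<bar>cos (28/5 * a)\<bar> \<le> exp (- (145/1000) * (28/5 * a)\<^sup>2)"
      using as[OF \<open>a \<in> set as\<close>] pi_approx by (intro abs_cos_le_exp[where b = "21/10"]) auto
    then show "\<bar>cos (28/5 * a)\<bar> \<le> exp (- (145/1000 * (28/5)\<^sup>2) * a\<^sup>2)"
      by (simp only: power_mult_distrib mult.assoc mult_minus_left)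
  qed
  moreover have "exp (- (145/1000 * (28/5)\<^sup>2) :: real) \<le> 12/1000"
    by (rule exp_neg_le[of 9]) (simp_all add: power2_eq_square power_divide)
  ultimately show "(\<Prod>a\<leftarrow>as. cos (28/5 * a)) \<le> 12/1000" using assms(1) by simp
qed

text \<open>With \<open>y = a\<^sup>2\<close>, the left factor is a Taylor polynomial below \<open>cos (7/5 a)\<close> and the right one is a Taylor
polynomial below \<open>exp (41/40 y)\<close>: a weight up to \<open>14/25\<close> loses at most a factor \<open>965/1000\<close> against the Gaussian
rate \<open>41/40\<close> of the other weights.\<close>
lemma first_factor_ge:
  assumes "0 \<le> y" "y \<le> (14/25)\<^sup>2"
  shows "965/1000 \<le> (1 - 49/50 * y + 2401/15000 * y\<^sup>2 - 117649/11250000 * y^3) * (1 + 41/40 * y + 1681/3200 * y\<^sup>2 :: real)"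
proof -
  have y: "y \<le> 3136/10000" using assms by (simp add: power2_eq_square)
  have "(1 - 49/50 * y + 2401/15000 * y\<^sup>2 - 117649/11250000 * y^3) * (1 + 41/40 * y + 1681/3200 * y\<^sup>2)
    = 1 + 9/200 * y - 76589/240000 * y\<^sup>2 - 65015209/180000000 * y^3
      + y^4 * (264117203/3600000000 - 197767969/36000000000 * y)"
    by (simp add: field_simps power2_eq_square power3_eq_cube power4_eq_xxxx)
  moreover have "0 \<le> y^4 * (264117203/3600000000 - 197767969/36000000000 * y)"
    using y by (intro mult_nonneg_nonneg) auto
  moreover have y2: "y\<^sup>2 \<le> 3136/10000 * y"
    using mult_right_mono[OF y assms(1)] by (simp add: power2_eq_square)
  moreover have "y^3 \<le> 3136/10000 * y\<^sup>2"
    using mult_right_mono[OF y, of "y\<^sup>2"] by (simp add: power2_eq_square power3_eq_cube)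
  ultimately show ?thesis using assms(1) y by linarith
qed

text \<open>The bounds on the weights keep all relevant angles below \<open>pi / 2\<close>: \<open>28/5 * 7/25 = 14/5 * 14/25 = 1.568\<close>. The
large weight costs little in the first product. In the last two its factor is bounded by 1, since the other
weights have variance at least \<open>1 - (14/25)\<^sup>2\<close>, which is enough to make these products tiny.\<close>
lemma rad_ge_one_large_weight:
  assumes ss: "ssq (a1 # as) = 1" and a1: "0 \<le> a1" "a1 \<le> 14/25"
    and as: "\<And>a. a \<in> set as \<Longrightarrow> 0 \<le> a \<and> a \<le> 7/25"
  shows "0.46 \<le> rad (a1 # as) (ind 1)"
proof (rule rad_ge_of_frequencies[OF ss])
  have v: "ssq as = 1 - a1\<^sup>2" using ss by simp
  have a1s: "a1\<^sup>2 \<le> (14/25)\<^sup>2" using a1 by (intro power_mono) auto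
  have as2: "a\<^sup>2 \<le> (7/25)\<^sup>2" if "a \<in> set as" for a using as[OF that] by (intro power_mono) auto
  {
    have r: "exp (- (41/40) * ssq as) \<le> (\<Prod>a\<leftarrow>as. cos (7/5 * a))"
      by (intro prod_cos_ge cos_7_5_ge[OF _ _ as2]) (simp_all add: power2_eq_square)
    define y where "y = a1\<^sup>2"
    have y: "0 \<le> y" "y \<le> (14/25)\<^sup>2" using a1s by (auto simp: y_def)
    have "965/1000 \<le> (1 - 49/50 * y + 2401/15000 * y\<^sup>2 - 117649/11250000 * y^3) * (1 + 41/40 * y + 1681/3200 * y\<^sup>2)"
      by (rule first_factor_ge[OF y])
    also have "\<dots> \<le> cos (7/5 * a1) * exp (41/40 * y)"
    proof (rule mult_mono)
      show "1 - 49/50 * y + 2401/15000 * y\<^sup>2 - 117649/11250000 * y^3 \<le> cos (7/5 * a1)"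
        using cos_ge6[of "7/5 * a1"] by (simp add: y_def power_mult_distrib power_divide flip: power_mult)
      show "1 + 41/40 * y + 1681/3200 * y\<^sup>2 \<le> exp (41/40 * y)"
        using exp_lower_Taylor_quadratic[of "41/40 * y"] y by (simp add: power2_eq_square field_simps)
      show "0 \<le> cos (7/5 * a1)" using a1 by (intro cos_nonneg_small) auto
      show "0 \<le> 1 + 41/40 * y + 1681/3200 * y\<^sup>2" using y by simp
    qed
    finally have c: "965/1000 * exp (- (41/40)) \<le> cos (7/5 * a1) * exp (41/40 * y) * exp (- (41/40))"
      by (intro mult_right_mono) auto
    have "3576/10000 \<le> exp (- (41/40) :: real)"
      using exp_ge_taylor[of 8 "- (41/40)"] by (simp add: lessThan_nat_numeral fact_numeral power_divide)
    then have "345/1000 \<le> cos (7/5 * a1) * (exp (41/40 * y) * exp (- (41/40)))" using c by linarith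
    also have "exp (41/40 * y) * exp (- (41/40)) = exp (- (41/40) * ssq as)"
      unfolding exp_add[symmetric] v y_def by (rule arg_cong[of _ _ exp]) (simp add: field_simps)
    also have "cos (7/5 * a1) * \<dots> \<le> cos (7/5 * a1) * (\<Prod>a\<leftarrow>as. cos (7/5 * a))"
      using r a1 by (intro mult_left_mono cos_nonneg_small) auto
    finally show "345/1000 \<le> (\<Prod>a\<leftarrow>a1 # as. cos (7/5 * a))" by simp
  next
    have "0 \<le> cos (14/5 * a)" if "a \<in> set (a1 # as)" for a
      using as[of a] a1 that by (intro cos_nonneg_small) auto
    then show "0 \<le> (\<Prod>a\<leftarrow>a1 # as. cos (14/5 * a))"
      by (intro prod_list_nonneg) auto
  next
    have "\<bar>\<Prod>a\<leftarrow>as. cos (t * a)\<bar> \<le> exp (- (1/2 * t\<^sup>2) * ssq as)" if "0 \<le> t" "t \<le> 28/5" for t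
    proof (rule abs_prod_cos_le)
      fix a assume a: "a \<in> set as"
      have "t * a \<le> 28/5 * (7/25)" using that as[OF a] by (intro mult_mono) auto
      then have "\<bar>cos (t * a)\<bar> \<le> exp (- (1/2) * (t * a)\<^sup>2)"
        using as[OF a] that pi_approx by (intro abs_cos_le_exp[where b = "pi/2"]) auto
      then show "\<bar>cos (t * a)\<bar> \<le> exp (- (1/2 * t\<^sup>2) * a\<^sup>2)"
        by (simp only: power_mult_distrib mult.assoc mult_minus_left)
    qed
    moreover have "exp (- (1/2 * t\<^sup>2) * ssq as) \<le> 1/100" if "21/5 \<le> t" for t
    proof -
      have "1 - (14/25)\<^sup>2 \<le> ssq as" using a1s v by linarith
      then have "1/2 * (21/5)\<^sup>2 * (1 - (14/25)\<^sup>2) \<le> 1/2 * t\<^sup>2 * ssq as"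
        using that by (intro mult_mono power_mono) (auto simp: power2_eq_square)
      then have "exp (- (1/2 * t\<^sup>2 * ssq as)) \<le> 1/100"
        by (intro exp_neg_le[of 12]) (simp_all add: power2_eq_square power_divide)
      then show ?thesis by simp
    qed
    ultimately have f: "\<bar>\<Prod>a\<leftarrow>as. cos (t * a)\<bar> \<le> 1/100" if "21/5 \<le> t" "t \<le> 28/5" for t
      using that by (meson order_trans dual_order.trans zero_le_divide_iff zero_le_numeral)
    have "(\<Prod>a\<leftarrow>a1 # as. cos (t * a)) \<le> 1/100" if "21/5 \<le> t" "t \<le> 28/5" for t
    proof -
      have "(\<Prod>a\<leftarrow>a1 # as. cos (t * a)) \<le> \<bar>cos (t * a1)\<bar> * \<bar>\<Prod>a\<leftarrow>as. cos (t * a)\<bar>"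
        by (simp flip: abs_mult)
      also have "\<dots> \<le> 1 * (1/100)" using f[OF that] by (intro mult_mono) auto
      finally show ?thesis by simp
    qed
    from this[of "21/5"] this[of "28/5"]
    show "(\<Prod>a\<leftarrow>a1 # as. cos (21/5 * a)) \<le> 1/100" "(\<Prod>a\<leftarrow>a1 # as. cos (28/5 * a)) \<le> 12/1000"
      by simp_all
  }
qed

section \<open>A dominant weight\<close>

text \<open>The square \<open>Y\<^sup>2\<close> of the rest has mean \<open>v = 1 - a\<^sup>2\<close> and variance at most \<open>2 v\<^sup>2\<close>, so Cantelli's inequality bounds the
probability of \<open>Y\<^sup>2 > (1 + a)\<^sup>2\<close> by \<open>(1 - a)\<^sup>2 / (2 a\<^sup>2 + (1 - a)\<^sup>2)\<close>. For
\<open>a \<ge> 353/500\<close> this is at most \<open>8/100\<close>, and half of it is lost from the conditional probability \<open>1/2\<close>.\<close>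
lemma rad_ge_dominant_weight:
  assumes ss: "ssq (a # as) = 1" and a: "353/500 \<le> a"
  shows "0.46 \<le> rad (a # as) (ind 1)"
proof -
  have v: "ssq as = 1 - a\<^sup>2" using ss by simp
  then have "a\<^sup>2 \<le> 1" using ssq_nonneg[of as] by linarith
  then have a1: "a \<le> 1" using a by (simp add: abs_square_le_1)
  \<comment> \<open>The probability is bounded by the expectation of \<open>(a Y\<^sup>2 + e)\<^sup>2\<close> divided by \<open>D\<^sup>2\<close>, the value of
    this square at \<open>Y = 1 + a\<close>. The shift \<open>e\<close> is the one that minimises the quotient.\<close>
  define e where "e = (1 - a\<^sup>2) * (1 - 2 * a)"
  define k where "k = 3 * a\<^sup>2 - 2 * a + 1"
  define D where "D = (1 + a) * k"
  have "k = 2 * a\<^sup>2 + (1 - a)\<^sup>2" by (simp add: k_def power2_eq_square algebra_simps)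
  then have k: "0 < k" using a by (simp add: add_pos_nonneg)
  then have D: "0 < D" using a by (simp add: D_def)
  have pt: "1/2 + (- 1/(2 * D\<^sup>2)) * (a\<^sup>2 * x^4 + (2 * a * e * x\<^sup>2 + e\<^sup>2)) \<le> avg a (ind 1) x" for x
  proof -
    have q: "a\<^sup>2 * x^4 + (2 * a * e * x\<^sup>2 + e\<^sup>2) = (a * x\<^sup>2 + e)\<^sup>2"
      by (simp add: power2_eq_square power4_eq_xxxx algebra_simps)
    show ?thesis
    proof (cases "\<bar>x\<bar> \<le> 1 + a")
      case True
      then have "ind 1 (x + a) = 1 \<or> ind 1 (x - a) = 1" using a a1 by (auto simp: ind_def abs_le_iff)
      then have "1/2 \<le> avg a (ind 1) x"
        using ind_nonneg[of 1 "x + a"] ind_nonneg[of 1 "x - a"] by (auto simp: avg_def)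
      moreover have "(- 1/(2 * D\<^sup>2)) * (a * x\<^sup>2 + e)\<^sup>2 \<le> 0" by (intro mult_nonpos_nonneg) auto
      ultimately show ?thesis unfolding q by linarith
    next
      case False
      have "(1 + a)\<^sup>2 \<le> \<bar>x\<bar>\<^sup>2" using False a by (intro power_mono) auto
      then have "a * (1 + a)\<^sup>2 + e \<le> a * x\<^sup>2 + e" using a by simp
      moreover have "a * (1 + a)\<^sup>2 + e = D"
        by (simp add: D_def k_def e_def power2_eq_square algebra_simps)
      ultimately have "D\<^sup>2 \<le> (a * x\<^sup>2 + e)\<^sup>2" using D by (intro power_mono) auto
      then have "1/2 + (- 1/(2 * D\<^sup>2)) * (a * x\<^sup>2 + e)\<^sup>2 \<le> 0" using D by (simp add: field_simps)
      also have "0 \<le> avg a (ind 1) x" by (simp add: avg_def ind_nonneg)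
      finally show ?thesis unfolding q .
    qed
  qed
  have "rad as (\<lambda>x. a\<^sup>2 * x^4 + (2 * a * e * x\<^sup>2 + e\<^sup>2)) = a\<^sup>2 * rad as (\<lambda>x. x^4) + (2 * a * e * ssq as + e\<^sup>2)"
    unfolding rad_add rad_scale rad_square rad_const by simp
  also have "\<dots> \<le> a\<^sup>2 * (3 * (ssq as)\<^sup>2) + (2 * a * e * ssq as + e\<^sup>2)"
    by (intro add_right_mono mult_left_mono rad_fourth_le) auto
  also have "\<dots> = (1 - a\<^sup>2)\<^sup>2 * k"
    unfolding v e_def k_def by algebra
  also have "\<dots> \<le> 8/100 * D\<^sup>2"
  proof -
    have "(1 - a)\<^sup>2 \<le> (147/500)\<^sup>2" using a a1 by (intro power_mono) auto
    moreover have "(353/500)\<^sup>2 \<le> a\<^sup>2" using a by (intro power_mono) auto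
    moreover have "k = 2 * a\<^sup>2 + (1 - a)\<^sup>2" by fact
    ultimately have "(1 - a)\<^sup>2 \<le> 8/100 * k" by (simp add: power_divide)
    then have "(1 - a)\<^sup>2 * ((1 + a)\<^sup>2 * k) \<le> 8/100 * k * ((1 + a)\<^sup>2 * k)"
      using k by (intro mult_right_mono) auto
    moreover have "(1 - a)\<^sup>2 * ((1 + a)\<^sup>2 * k) = (1 - a\<^sup>2)\<^sup>2 * k" by algebra
    moreover have "8/100 * k * ((1 + a)\<^sup>2 * k) = 8/100 * D\<^sup>2" by (simp add: D_def power2_eq_square)
    ultimately show ?thesis by linarith
  qed
  finally have "rad as (\<lambda>x. a\<^sup>2 * x^4 + (2 * a * e * x\<^sup>2 + e\<^sup>2)) / (2 * D\<^sup>2) \<le> 4/100"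
    using D by (simp add: field_simps)
  moreover have "rad as (\<lambda>x. 1/2 + (- 1/(2 * D\<^sup>2)) * (a\<^sup>2 * x^4 + (2 * a * e * x\<^sup>2 + e\<^sup>2))) \<le> rad as (avg a (ind 1))"
    by (intro rad_mono pt)
  ultimately show ?thesis
    unfolding rad_add[of as "\<lambda>x. 1/2"] rad_scale[of as "- 1/(2 * D\<^sup>2)"] rad_const by simp
qed

section \<open>One large weight and two stopped blocks\<close>

text \<open>The step function is at least \<open>6/8\<close> up to \<open>1 - a + (u - w)\<close> and then loses \<open>1/8\<close> at each of the points
listed; \<open>u + w \<le> a\<close> puts these points into increasing order.\<close>
lemma three_blocks_pointwise:
  assumes uw: "0 \<le> w" "w \<le> u" "u + w \<le> a" "a + u \<le> 1" and g: "0 \<le> g" and y: "0 \<le> y"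
    and "L \<le> 6/8"
    and "L - g * (1 - a + (u - w))\<^sup>2 \<le> 5/8"
    and "L - g * (1 - a + (u + w))\<^sup>2 \<le> 4/8"
    and "L - g * (1 + a - (u + w))\<^sup>2 \<le> 3/8"
    and "L - g * (1 + a - (u - w))\<^sup>2 \<le> 2/8"
    and "L - g * (1 + a + (u - w))\<^sup>2 \<le> 1/8"
    and "L - g * (1 + a + (u + w))\<^sup>2 \<le> 0"
  shows "L - g * y\<^sup>2 \<le> avg w (avg u (avg a (ind 1))) y"
proof -
  let ?I = "ind 1"
  have N: "8 * avg w (avg u (avg a ?I)) y =
    (?I (y + w + u + a) + ?I (y + w + u - a) + ?I (y + w - u + a) + ?I (y + w - u - a)
     + ?I (y - w + u + a) + ?I (y - w + u - a) + ?I (y - w - u + a) + ?I (y - w - u - a))"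
    by (simp add: avg_def field_simps)
  note nn = ind_nonneg[of 1 "y + w + u + a"] ind_nonneg[of 1 "y + w + u - a"]
    ind_nonneg[of 1 "y + w - u + a"] ind_nonneg[of 1 "y + w - u - a"]
    ind_nonneg[of 1 "y - w + u + a"] ind_nonneg[of 1 "y - w + u - a"]
    ind_nonneg[of 1 "y - w - u + a"] ind_nonneg[of 1 "y - w - u - a"]
  note step = quadratic_step[OF _ _ _ g, where y = y and L = L]
  consider "y \<le> 1 - a - (u - w)" | "1 - a - (u - w) < y" "y \<le> 1 - a + (u - w)"
    | "1 - a + (u - w) < y" "y \<le> 1 - a + (u + w)" | "1 - a + (u + w) < y" "y \<le> 1 + a - (u + w)"
    | "1 + a - (u + w) < y" "y \<le> 1 + a - (u - w)" | "1 + a - (u - w) < y" "y \<le> 1 + a + (u - w)"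
    | "1 + a + (u - w) < y" "y \<le> 1 + a + (u + w)" | "1 + a + (u + w) < y" by linarith
  then show ?thesis
  proof cases
    case 1
    then have "?I (y - w + u + a) = 1" "?I (y + w - u - a) = 1" "?I (y + w - u + a) = 1"
      "?I (y - w + u - a) = 1" "?I (y - w - u + a) = 1" "?I (y + w + u - a) = 1"
      using uw y by (intro ind_1_eq_1; linarith)+
    moreover have "0 \<le> g * y\<^sup>2" using g by simp
    ultimately show ?thesis using N nn assms(7) by linarith
  next
    case 2
    then have "?I (y - w - u - a) = 1" "?I (y + w - u - a) = 1" "?I (y + w - u + a) = 1"
      "?I (y - w + u - a) = 1" "?I (y - w - u + a) = 1" "?I (y + w + u - a) = 1"
      using uw y by (intro ind_1_eq_1; linarith)+
    moreover have "0 \<le> g * y\<^sup>2" using g by simp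
    ultimately show ?thesis using N nn assms(7) by linarith
  next
    case 3
    then have "?I (y - w - u - a) = 1" "?I (y + w - u - a) = 1"
      "?I (y - w + u - a) = 1" "?I (y - w - u + a) = 1" "?I (y + w + u - a) = 1"
      using uw y by (intro ind_1_eq_1; linarith)+
    moreover have "L - g * y\<^sup>2 \<le> 5/8" using 3 uw by (intro step[OF assms(8)]) auto
    ultimately show ?thesis using N nn by linarith
  next
    case 4
    then have "?I (y - w - u - a) = 1" "?I (y + w - u - a) = 1"
      "?I (y - w + u - a) = 1" "?I (y + w + u - a) = 1"
      using uw y by (intro ind_1_eq_1; linarith)+
    moreover have "L - g * y\<^sup>2 \<le> 4/8" using 4 uw by (intro step[OF assms(9)]) auto
    ultimately show ?thesis using N nn by linarith
  next
    case 5
    then have "?I (y - w - u - a) = 1" "?I (y + w - u - a) = 1" "?I (y - w + u - a) = 1"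
      using uw y by (intro ind_1_eq_1; linarith)+
    moreover have "L - g * y\<^sup>2 \<le> 3/8" using 5 uw by (intro step[OF assms(10)]) auto
    ultimately show ?thesis using N nn by linarith
  next
    case 6
    then have "?I (y - w - u - a) = 1" "?I (y + w - u - a) = 1"
      using uw y by (intro ind_1_eq_1; linarith)+
    moreover have "L - g * y\<^sup>2 \<le> 2/8" using 6 uw by (intro step[OF assms(11)]) auto
    ultimately show ?thesis using N nn by linarith
  next
    case 7
    then have "?I (y - w - u - a) = 1"
      using uw y by (intro ind_1_eq_1; linarith)+
    moreover have "L - g * y\<^sup>2 \<le> 1/8" using 7 uw by (intro step[OF assms(12)]) auto
    ultimately show ?thesis using N nn by linarith
  next
    case 8
    have "L - g * y\<^sup>2 \<le> 0" using 8 uw by (intro step[OF assms(13)]) auto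
    then show ?thesis using N nn by linarith
  qed
qed

text \<open>With \<open>l = 7/50\<close> the weights are at most \<open>2 l\<close>, so two blocks \<open>u\<close> and \<open>w\<close> can be stopped one after the other. In
both parabolas \<open>L = 46/100 + g (1 - a\<^sup>2)\<close>, the smallest value that yields 0.46; the slope \<open>g\<close> is flatter if
\<open>u + w\<close> is small, where the step function falls to \<open>4/8\<close> earlier but then keeps that value longer.\<close>
lemma rad_ge_three_blocks:
  assumes ss: "ssq (a # as) = 1" and a: "14/25 \<le> a" "a \<le> 353/500"
    and as: "\<And>w. w \<in> set as \<Longrightarrow> 0 \<le> w \<and> w \<le> 7/25"
  shows "0.46 \<le> rad (a # as) (ind 1)"
proof -
  let ?N = "avg a (ind 1)"
  have v: "ssq as = 1 - a\<^sup>2" using ss by simp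
  have e1: "even_fun ?N" by (intro even_fun_avg even_fun_ind)
  have c3: "0.46 \<le> rad rs (avg w (avg u ?N))"
    if uw: "7/50 \<le> u" "u \<le> 7/25" "7/50 \<le> w" "w \<le> u" and rs: "ssq rs \<le> 1 - a\<^sup>2" for u w rs
  proof -
    \<comment> \<open>These squares show that the conditions at the steps hold for all \<open>a\<close> in the range.\<close>
    have sqm: "(2 * a - 1)\<^sup>2 \<ge> 0" "(25 * a - 16)\<^sup>2 \<ge> 0" "(10 * a - 7)\<^sup>2 \<ge> 0" by simp_all
    have a2: "(14/25)\<^sup>2 \<le> a\<^sup>2" using a by (intro power_mono) auto
    have e3: "even_fun (avg w (avg u ?N))" by (intro even_fun_avg even_fun_ind)
    have p: "(1 - a)\<^sup>2 \<le> (1 - a + (u - w))\<^sup>2" "(43/50 + a)\<^sup>2 \<le> (1 + a - (u - w))\<^sup>2"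
      "(1 + a)\<^sup>2 \<le> (1 + a + (u - w))\<^sup>2"
      using uw a by (auto intro!: power_mono)
    show ?thesis
    proof (cases "u + w \<le> 2/5")
      case True
      have q: "(32/25 - a)\<^sup>2 \<le> (1 - a + (u + w))\<^sup>2" "(3/5 + a)\<^sup>2 \<le> (1 + a - (u + w))\<^sup>2"
        "(32/25 + a)\<^sup>2 \<le> (1 + a + (u + w))\<^sup>2"
        using uw a True by (auto intro!: power_mono)
      show ?thesis
      proof (rule rad_ge_quadratic_even[where L = "66/100 - 2/10 * a\<^sup>2" and g = "2/10", OF e3 _ _ rs])
        fix y :: real assume "0 \<le> y"
        then show "66/100 - 2/10 * a\<^sup>2 - 2/10 * y\<^sup>2 \<le> avg w (avg u ?N) y"
          using uw a a2 p q sqm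
          by (intro three_blocks_pointwise) (simp_all add: power2_eq_square algebra_simps)
      qed (simp_all add: field_simps)
    next
      case False
      have q: "(7/5 - a)\<^sup>2 \<le> (1 - a + (u + w))\<^sup>2" "(11/25 + a)\<^sup>2 \<le> (1 + a - (u + w))\<^sup>2"
        "(7/5 + a)\<^sup>2 \<le> (1 + a + (u + w))\<^sup>2"
        using uw a False by (auto intro!: power_mono)
      show ?thesis
      proof (rule rad_ge_quadratic_even[where L = "76/100 - 3/10 * a\<^sup>2" and g = "3/10", OF e3 _ _ rs])
        fix y :: real assume "0 \<le> y"
        then show "76/100 - 3/10 * a\<^sup>2 - 3/10 * y\<^sup>2 \<le> avg w (avg u ?N) y"
          using uw a a2 p q sqm
          by (intro three_blocks_pointwise) (simp_all add: power2_eq_square algebra_simps)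
      qed (simp_all add: field_simps)
    qed
  qed
  have "0.46 \<le> rad as ?N"
  proof (rule rad_block[OF e1, where l = "7/50"])
    fix y :: real assume "\<bar>y\<bar> < 7/50"
    then show "0.46 \<le> ?N y" using a by (simp add: avg_def ind_def abs_le_iff)
  next
    fix u rs
    assume u: "7/50 \<le> u" "u \<le> 2 * (7/50)" and sub: "set rs \<subseteq> set as" and sr: "ssq rs + (u - 7/50)\<^sup>2 \<le> ssq as"
    show "0.46 \<le> rad rs (avg u ?N)"
    proof (rule rad_block[where l = "7/50"])
      fix y :: real assume y: "\<bar>y\<bar> < 7/50"
      have "ind 1 (y + u - a) = 1" "ind 1 (y - u + a) = 1"
        using y u a by (intro ind_1_eq_1; linarith)+
      moreover have "4 * avg u ?N y = ind 1 (y + u + a) + ind 1 (y + u - a) + ind 1 (y - u + a) + ind 1 (y - u - a)"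
        by (simp add: avg_def field_simps)
      ultimately show "0.46 \<le> avg u ?N y"
        using ind_nonneg[of 1 "y + u + a"] ind_nonneg[of 1 "y - u - a"] by simp
    next
      fix w ss
      assume w: "7/50 \<le> w" "w \<le> 2 * (7/50)" and ws: "ssq ss + (w - 7/50)\<^sup>2 \<le> ssq rs"
      have "ssq ss \<le> 1 - a\<^sup>2"
        using ws sr v zero_le_power2[of "w - 7/50"] zero_le_power2[of "u - 7/50"] by linarith
      then show "0.46 \<le> rad ss (avg w (avg u ?N))"
        using c3[of u w ss] c3[of w u ss] u w avg_commute[of w u ?N] by (cases "w \<le> u") auto
    qed (use as sub in \<open>force intro: even_fun_avg e1\<close>)+
  qed (use as in \<open>force\<close>)+
  then show ?thesis by simp
qed

section \<open>Two large weights with sum at most one\<close>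

lemma pair_pointwise:
  assumes ab: "0 \<le> b" "b \<le> a" "a + b \<le> 1" and g: "0 \<le> g" and y: "0 \<le> y"
    and "L \<le> 1"
    and "L - g * (1 - (a + b))\<^sup>2 \<le> 3/4"
    and "L - g * (1 - (a - b))\<^sup>2 \<le> 2/4"
    and "L - g * (1 + (a - b))\<^sup>2 \<le> 1/4"
    and "L - g * (1 + (a + b))\<^sup>2 \<le> 0"
  shows "L - g * y\<^sup>2 \<le> avg b (avg a (ind 1)) y"
proof -
  let ?I = "ind 1"
  have N: "4 * avg b (avg a ?I) y = ?I (y + b + a) + ?I (y + b - a) + ?I (y - b + a) + ?I (y - b - a)"
    by (simp add: avg_def field_simps)
  note nn = ind_nonneg[of 1 "y + b + a"] ind_nonneg[of 1 "y + b - a"]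
    ind_nonneg[of 1 "y - b + a"] ind_nonneg[of 1 "y - b - a"]
  note step = quadratic_step[OF _ _ _ g, where y = y and L = L]
  consider "y \<le> 1 - (a + b)" | "1 - (a + b) < y" "y \<le> 1 - (a - b)"
    | "1 - (a - b) < y" "y \<le> 1 + (a - b)" | "1 + (a - b) < y" "y \<le> 1 + (a + b)"
    | "1 + (a + b) < y" by linarith
  then show ?thesis
  proof cases
    case 1
    then have "?I (y + b + a) = 1" "?I (y + b - a) = 1" "?I (y - b + a) = 1" "?I (y - b - a) = 1"
      using ab y by (intro ind_1_eq_1; linarith)+
    moreover have "0 \<le> g * y\<^sup>2" using g by simp
    ultimately show ?thesis using N nn assms(6) by linarith
  next
    case 2
    then have "?I (y + b - a) = 1" "?I (y - b + a) = 1" "?I (y - b - a) = 1"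
      using ab y by (intro ind_1_eq_1; linarith)+
    moreover have "L - g * y\<^sup>2 \<le> 3/4" using 2 ab by (intro step[OF assms(7)]) auto
    ultimately show ?thesis using N nn by linarith
  next
    case 3
    then have "?I (y + b - a) = 1" "?I (y - b - a) = 1"
      using ab y by (intro ind_1_eq_1; linarith)+
    moreover have "L - g * y\<^sup>2 \<le> 2/4" using 3 ab by (intro step[OF assms(8)]) auto
    ultimately show ?thesis using N nn by linarith
  next
    case 4
    then have "?I (y - b - a) = 1"
      using ab y by (intro ind_1_eq_1; linarith)+
    moreover have "L - g * y\<^sup>2 \<le> 1/4" using 4 ab by (intro step[OF assms(9)]) auto
    ultimately show ?thesis using N nn by linarith
  next
    case 5
    have "L - g * y\<^sup>2 \<le> 0" using 5 ab by (intro step[OF assms(10)]) auto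
    then show ?thesis using N nn by linarith
  qed
qed

text \<open>On \<open>[-r, r]\<close> the step function takes only the values 1 and \<open>3/4\<close>, so there the vertex of the parabola may be
raised from \<open>L\<close> to \<open>M\<close>.\<close>
lemma pair_ind_pointwise:
  assumes ab: "0 \<le> b" "b \<le> a" "a + b \<le> 1" and g: "0 \<le> g" and y: "0 \<le> y"
    and r: "r \<le> 1 - (a - b)"
    and "M \<le> 1" "M - g * (1 - (a + b))\<^sup>2 \<le> 3/4"
    and "L \<le> 3/4" "L - g * (1 - (a - b))\<^sup>2 \<le> 2/4"
    and "L - g * (1 + (a - b))\<^sup>2 \<le> 1/4"
    and "L - g * (1 + (a + b))\<^sup>2 \<le> 0"
  shows "L + (M - L) * ind r y - g * y\<^sup>2 \<le> avg b (avg a (ind 1)) y"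
proof -
  let ?I = "ind 1"
  have N: "4 * avg b (avg a ?I) y = ?I (y + b + a) + ?I (y + b - a) + ?I (y - b + a) + ?I (y - b - a)"
    by (simp add: avg_def field_simps)
  note nn = ind_nonneg[of 1 "y + b + a"] ind_nonneg[of 1 "y + b - a"]
    ind_nonneg[of 1 "y - b + a"] ind_nonneg[of 1 "y - b - a"]
  note step = quadratic_step[OF _ _ _ g, where y = y]
  have gy: "0 \<le> g * y\<^sup>2" using g by simp
  show ?thesis
  proof (cases "y \<le> r")
    case True
    then have e: "L + (M - L) * ind r y = M" using y by (simp add: ind_def)
    have d: "?I (y + b - a) = 1" "?I (y - b + a) = 1" "?I (y - b - a) = 1"
      using ab y True r by (intro ind_1_eq_1; linarith)+
    show ?thesis
    proof (cases "y \<le> 1 - (a + b)")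
      case True
      then have "?I (y + b + a) = 1" using ab y by (intro ind_1_eq_1; linarith)
      then show ?thesis using N d gy assms(7) unfolding e by linarith
    next
      case False
      then have "M - g * y\<^sup>2 \<le> 3/4" using ab by (intro step[OF assms(8)]) auto
      then show ?thesis using N d nn unfolding e by linarith
    qed
  next
    case False
    then have e: "L + (M - L) * ind r y = L" using y by (simp add: ind_def)
    consider "y \<le> 1 - (a - b)"
      | "1 - (a - b) < y" "y \<le> 1 + (a - b)" | "1 + (a - b) < y" "y \<le> 1 + (a + b)"
      | "1 + (a + b) < y" by linarith
    then show ?thesis unfolding e
    proof cases
      case 1
      then have "?I (y + b - a) = 1" "?I (y - b + a) = 1" "?I (y - b - a) = 1"
        using ab y by (intro ind_1_eq_1; linarith)+
      then show "L - g * y\<^sup>2 \<le> avg b (avg a ?I) y" using N nn gy assms(9) by linarith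
    next
      case 2
      then have "?I (y + b - a) = 1" "?I (y - b - a) = 1"
        using ab y by (intro ind_1_eq_1; linarith)+
      moreover have "L - g * y\<^sup>2 \<le> 2/4" using 2 ab by (intro step[OF assms(10)]) auto
      ultimately show "L - g * y\<^sup>2 \<le> avg b (avg a ?I) y" using N nn by linarith
    next
      case 3
      then have "?I (y - b - a) = 1"
        using ab y by (intro ind_1_eq_1; linarith)+
      moreover have "L - g * y\<^sup>2 \<le> 1/4" using 3 ab by (intro step[OF assms(11)]) auto
      ultimately show "L - g * y\<^sup>2 \<le> avg b (avg a ?I) y" using N nn by linarith
    next
      case 4
      have "L - g * y\<^sup>2 \<le> 0" using 4 ab by (intro step[OF assms(12)]) auto
      then show "L - g * y\<^sup>2 \<le> avg b (avg a ?I) y" using N nn by linarith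
    qed
  qed
qed

text \<open>Let \<open>s = a + b\<close> and \<open>d = a - b\<close>; then \<open>v = 1 - (s\<^sup>2 + d\<^sup>2) / 2\<close> is the variance of the rest, and the assumption
on \<open>2 d - \<dots>\<close> is \<open>v \<le> (1 - d)\<^sup>2\<close>. The first five conclusions make the minorant of \<open>pair_ind_pointwise\<close> with \<open>M = 3/4 + g (1 - s)\<^sup>2\<close>
and \<open>L = 1/4 + g (1 + d)\<^sup>2\<close> valid. The last one says that its expectation
\<open>0.46 M + 0.54 L - g v\<close> is at least 0.46: without \<open>g\<close> it is 0.48, so at most \<open>2/100\<close> may be lost.\<close>
lemma small_gap_slope:
  fixes s d :: real
  assumes s: "s \<le> 1" "14/25 + d \<le> s" "3/4 \<le> s + d" and d: "0 \<le> d"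
    and X: "2 * d - 3/2 * d\<^sup>2 - s\<^sup>2 / 2 \<le> 0"
  obtains g where "0 \<le> g" "g * (1 - s)\<^sup>2 \<le> 1/4" "g * (1 + d)\<^sup>2 \<le> 1/2" "g * (4 * d) \<le> 1/4"
    "1/4 \<le> g * ((1 + s)\<^sup>2 - (1 + d)\<^sup>2)"
    "g * (92/100 * s - 96/100 * s\<^sup>2 - 108/100 * d - 104/100 * d\<^sup>2) \<le> 2/100"
proof -
  note pick = that
  have "s\<^sup>2 \<le> 1\<^sup>2" using s d by (intro power_mono) auto
  then have "0 \<le> (1 - 3 * d) * (1 - d)" using X by (simp add: power2_eq_square algebra_simps)
  then have d3: "d \<le> 1/3" using s by (simp add: zero_le_mult_iff)
  have d2: "(1 + d)\<^sup>2 \<le> (4/3)\<^sup>2" using d d3 by (intro power_mono) auto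
  have s2: "(1 - s)\<^sup>2 \<le> 1\<^sup>2" using s d by (intro power_mono) auto
  have f: "(1 + s)\<^sup>2 - (1 + d)\<^sup>2 = (s - d) * (2 + (s + d))" by (simp add: power2_eq_square algebra_simps)
  have fin: thesis
    if g: "0 \<le> g" "g \<le> 37/200" and p: "1/4 \<le> g * ((s - d) * (2 + (s + d)))"
      and q: "g * (92/100 * s - 96/100 * s\<^sup>2 - 108/100 * d - 104/100 * d\<^sup>2) \<le> 2/100" for g
  proof (rule pick[of g])
    have "g * (1 - s)\<^sup>2 \<le> 37/200 * 1\<^sup>2" using g s2 by (intro mult_mono) auto
    then show "g * (1 - s)\<^sup>2 \<le> 1/4" by simp
    have "g * (1 + d)\<^sup>2 \<le> 37/200 * (4/3)\<^sup>2" using g d2 by (intro mult_mono) auto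
    then show "g * (1 + d)\<^sup>2 \<le> 1/2" by (simp add: power2_eq_square)
    have "g * (4 * d) \<le> 37/200 * (4/3)" using g d d3 by (intro mult_mono) auto
    then show "g * (4 * d) \<le> 1/4" by simp
  qed (use g p q f in auto)
  show ?thesis
  proof (cases "d \<le> 1/10")
    case True
    \<comment> \<open>For \<open>d = 0\<close> and \<open>s = 3/4\<close> the slope may not exceed \<open>2/15\<close> and not be less than \<open>4/33\<close>; it has to
      grow with \<open>d\<close> because the drops at \<open>1 + d\<close> and \<open>1 + s\<close> come closer to each other.\<close>
    define g where "g = 1/8 + 3/5 * d"
    have g: "0 \<le> g" "g \<le> 37/200" using d True by (auto simp: g_def)
    have "(3/4 - 2 * d) * (11/4) \<le> (s - d) * (2 + (s + d))" using s d by (intro mult_mono) auto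
    then have "g * ((3/4 - 2 * d) * (11/4)) \<le> g * ((s - d) * (2 + (s + d)))"
      using g by (intro mult_left_mono)
    moreover have "1/4 \<le> g * ((3/4 - 2 * d) * (11/4))"
    proof -
      have "d * d \<le> 1/10 * d" using True d by (intro mult_right_mono) auto
      then show ?thesis using d by (simp add: g_def algebra_simps)
    qed
    moreover have "92/100 * s - 96/100 * s\<^sup>2 - 108/100 * d - 104/100 * d\<^sup>2 \<le> 15/100 - 56/100 * d"
    proof -
      have "0 \<le> (s - (3/4 - d)) * (96/100 * (s + (3/4 - d)) - 92/100)"
        using s d True by (intro mult_nonneg_nonneg) auto
      also have "\<dots> = 96/100 * s\<^sup>2 - 92/100 * s + 15/100 + 52/100 * d - 96/100 * d\<^sup>2"
        by (simp add: power2_eq_square field_simps)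
      finally show ?thesis using zero_le_power2[of d] by linarith
    qed
    then have "g * (92/100 * s - 96/100 * s\<^sup>2 - 108/100 * d - 104/100 * d\<^sup>2) \<le> g * (15/100 - 56/100 * d)"
      using g by (intro mult_left_mono)
    moreover have "g * (15/100 - 56/100 * d) \<le> 2/100"
    proof -
      have "g * (15/100 - 56/100 * d) = 1875/100000 + 2/100 * d - 336/1000 * d\<^sup>2"
        by (simp add: g_def power2_eq_square field_simps)
      moreover have "(d - 3/100)\<^sup>2 = d\<^sup>2 - 6/100 * d + 9/10000" by (simp add: power2_eq_square field_simps)
      ultimately show ?thesis using zero_le_power2[of "d - 3/100"] zero_le_power2[of d] by linarith
    qed
    ultimately show ?thesis using g by (intro fin[of g]) linarith+
  next
    case False
    have "(14/25) * (69/25) \<le> (s - d) * (2 + (s + d))" using s d False by (intro mult_mono) auto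
    moreover have "92/100 * s - 96/100 * s\<^sup>2 - 108/100 * d - 104/100 * d\<^sup>2 \<le> 1/10"
    proof -
      have "0 \<le> (s - 66/100) * (96/100 * (s + 66/100) - 92/100)"
        using s d False by (intro mult_nonneg_nonneg) auto
      also have "\<dots> = 96/100 * s\<^sup>2 - 92/100 * s + 189024/1000000"
        by (simp add: power2_eq_square field_simps)
      finally show ?thesis using False zero_le_power2[of d] by linarith
    qed
    ultimately show ?thesis by (intro fin[of "37/200"]) auto
  qed
qed

text \<open>The step function drops to \<open>2/4\<close> at \<open>1 - d\<close>, where \<open>d = a - b\<close>. If the standard deviation of the rest is at most
\<open>1 - d\<close>, the induction hypothesis guarantees the value \<open>3/4\<close> often enough. Otherwise \<open>d\<close> is bounded away from 0, the
value \<open>2/4\<close> is kept on the long interval up to \<open>1 + d\<close>, and a parabola alone suffices.\<close>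
lemma rad_ge_short_pair:
  assumes ss: "ssq (a # b # as) = 1" and ab: "3/8 \<le> a" "7/25 \<le> b" "b \<le> a" "a + b \<le> 1"
    and IH: "0.46 \<le> rad as (ind (sqrt (ssq as)))"
  shows "0.46 \<le> rad (a # b # as) (ind 1)"
proof -
  let ?N = "avg b (avg a (ind 1))"
  define s d where "s = a + b" and "d = a - b"
  define v where "v = 1 - (s\<^sup>2 + d\<^sup>2) / 2"
  have v: "ssq as = v" using ss by (simp add: v_def s_def d_def power2_eq_square field_simps)
  have s: "s \<le> 1" "14/25 + d \<le> s" "3/4 \<le> s + d" and d: "0 \<le> d" using ab by (auto simp: s_def d_def)
  have e: "even_fun ?N" by (intro even_fun_avg even_fun_ind)
  have "0.46 \<le> rad as ?N"
  proof (cases "2 * d - 3/2 * d\<^sup>2 - s\<^sup>2 / 2 \<le> 0")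
    case True
    obtain g where g: "0 \<le> g" "g * (1 - s)\<^sup>2 \<le> 1/4" "g * (1 + d)\<^sup>2 \<le> 1/2" "g * (4 * d) \<le> 1/4"
      "1/4 \<le> g * ((1 + s)\<^sup>2 - (1 + d)\<^sup>2)"
      "g * (92/100 * s - 96/100 * s\<^sup>2 - 108/100 * d - 104/100 * d\<^sup>2) \<le> 2/100"
      by (rule small_gap_slope[OF s d True])
    define M L where "M = 3/4 + g * (1 - s)\<^sup>2" and "L = 1/4 + g * (1 + d)\<^sup>2"
    \<comment> \<open>The standard deviation of the rest does not exceed \<open>1 - d\<close>, where the value \<open>3/4\<close> ends.\<close>
    have "v \<le> (1 - d)\<^sup>2" using True by (simp add: v_def power2_eq_square field_simps)
    then have "sqrt v \<le> sqrt ((1 - d)\<^sup>2)" by (rule real_sqrt_le_mono)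
    then have r: "sqrt v \<le> 1 - (a - b)" using s d by (simp add: d_def)
    have g1: "0 \<le> g * (1 - s)\<^sup>2" using g by simp
    have "L + (M - L) * 0.46 - g * ssq as \<le> rad as ?N"
    proof (rule rad_ge_quadratic_ind[OF e])
      fix y :: real assume y: "0 \<le> y"
      show "L + (M - L) * ind (sqrt v) y - g * y\<^sup>2 \<le> ?N y"
      proof (rule pair_ind_pointwise[OF _ _ _ g(1) y r])
        have "g * (1 + d)\<^sup>2 - g * (1 - d)\<^sup>2 = g * (4 * d)" by (simp add: power2_eq_square algebra_simps)
        then show "L - g * (1 - (a - b))\<^sup>2 \<le> 2/4" using g(4) by (simp add: L_def d_def[symmetric])
        show "L - g * (1 + (a + b))\<^sup>2 \<le> 0"
          using g(5) by (simp add: L_def s_def[symmetric] algebra_simps)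
      qed (use ab g in \<open>auto simp: M_def L_def s_def d_def\<close>)
    next
      show "0 \<le> M - L" using g(3) g1 unfolding M_def L_def by linarith
    qed (use IH v in simp)
    moreover have "L + (M - L) * 0.46 - g * v
      = 48/100 - g * (92/100 * s - 96/100 * s\<^sup>2 - 108/100 * d - 104/100 * d\<^sup>2)"
      by (simp add: M_def L_def v_def power2_eq_square field_simps)
    ultimately show ?thesis using g(6) v by simp
  next
    case False
    have s2: "(14/25 + d)\<^sup>2 \<le> s\<^sup>2" using s d by (intro power_mono) auto
    have X: "2 * d - 3/2 * d\<^sup>2 - s\<^sup>2 / 2 \<le> 144/100 * d - 2 * d\<^sup>2 - 1568/10000"
      using s2 by (simp add: power2_eq_square algebra_simps)
    have dpos: "2/15 \<le> d"
    proof (rule ccontr)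
      assume "\<not> 2/15 \<le> d"
      then have "0 \<le> (2/15 - d) * (144/100 - 2 * (2/15 + d))" by (intro mult_nonneg_nonneg) auto
      also have "\<dots> = 192/1000 - 8/225 - 144/100 * d + 2 * d\<^sup>2" by (simp add: power2_eq_square field_simps)
      finally show False using X False by linarith
    qed
    \<comment> \<open>The drops to \<open>2/4\<close> at \<open>1 - d\<close> and to \<open>1/4\<close> at \<open>1 + d\<close> limit the slope from above and below. The squares of
      these points differ by \<open>4 d\<close>, so the natural slope is a multiple of \<open>1 / d\<close>.\<close>
    define g where "g = 29/500 / d"
    have g: "0 \<le> g" "g * d = 29/500" using dpos by (auto simp: g_def)
    have up: "g * E \<le> c * (29/500)" if "E \<le> c * d" for E c
      using mult_left_mono[OF that g(1)] g(2) by (simp add: mult.left_commute)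
    have lo: "c * (29/500) \<le> g * E" if "c * d \<le> E" for E c
      using mult_left_mono[OF that g(1)] g(2) by (simp add: mult.left_commute)
    have d44: "d \<le> 11/25" using s by linarith
    show ?thesis
    proof (rule rad_ge_quadratic_even[where L = "46/100 + g * v" and g = g and V = v, OF e _ g(1)])
      fix y :: real assume y: "0 \<le> y"
      show "46/100 + g * v - g * y\<^sup>2 \<le> ?N y"
      proof (rule pair_pointwise[OF _ _ _ g(1) y])
        have "v \<le> 9 * d"
          using dpos zero_le_power2[of s] zero_le_power2[of d] unfolding v_def add_divide_distrib by linarith
        from up[OF this] show "46/100 + g * v \<le> 1" by simp
        have "v - (1 - s)\<^sup>2 \<le> 5 * d"
        proof -
          have "v - (1 - s)\<^sup>2 = 2 * s - 3/2 * s\<^sup>2 - 1/2 * d\<^sup>2"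
            by (simp add: v_def power2_eq_square field_simps)
          moreover have "(3 * s - 2)\<^sup>2 = 9 * s\<^sup>2 - 12 * s + 4" by (simp add: power2_eq_square algebra_simps)
          ultimately show ?thesis
            using dpos zero_le_power2[of "3 * s - 2"] zero_le_power2[of d] by linarith
        qed
        from up[OF this] show "46/100 + g * v - g * (1 - (a + b))\<^sup>2 \<le> 3/4"
          by (simp add: s_def[symmetric] algebra_simps)
        have "v - (1 - d)\<^sup>2 \<le> 68/100 * d"
        proof -
          have "v - (1 - d)\<^sup>2 = 2 * d - 3/2 * d\<^sup>2 - s\<^sup>2 / 2"
            by (simp add: v_def power2_eq_square field_simps)
          moreover have "(d - 19/100)\<^sup>2 = d\<^sup>2 - 38/100 * d + 361/10000"
            by (simp add: power2_eq_square field_simps)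
          ultimately show ?thesis using X zero_le_power2[of "d - 19/100"] by linarith
        qed
        from up[OF this] show "46/100 + g * v - g * (1 - (a - b))\<^sup>2 \<le> 2/4"
          by (simp add: d_def[symmetric] algebra_simps)
        have "363/100 * d \<le> (1 + d)\<^sup>2 - v"
        proof -
          have "(1 + d)\<^sup>2 - v = 4 * d - (2 * d - 3/2 * d\<^sup>2 - s\<^sup>2 / 2)"
            by (simp add: v_def power2_eq_square field_simps)
          moreover have "(d - 107/400)\<^sup>2 = d\<^sup>2 - 107/200 * d + 11449/160000"
            by (simp add: power2_eq_square field_simps)
          ultimately show ?thesis using X zero_le_power2[of "d - 107/400"] by linarith
        qed
        from lo[OF this] show "46/100 + g * v - g * (1 + (a - b))\<^sup>2 \<le> 1/4"
          by (simp add: d_def[symmetric] algebra_simps)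
        have "794/100 * d \<le> (1 + s)\<^sup>2 - v"
        proof -
          have "(1 + s)\<^sup>2 - v = 2 * s + 3/2 * s\<^sup>2 + 1/2 * d\<^sup>2"
            by (simp add: v_def power2_eq_square field_simps)
          moreover have "(14/25 + d)\<^sup>2 = 196/625 + 28/25 * d + d\<^sup>2" "(d - 44/100)\<^sup>2 = d\<^sup>2 - 88/100 * d + 1936/10000"
            by (simp_all add: power2_eq_square field_simps)
          ultimately show ?thesis using s2 s d44 zero_le_power2[of "d - 44/100"] by linarith
        qed
        from lo[OF this] show "46/100 + g * v - g * (1 + (a + b))\<^sup>2 \<le> 0"
          by (simp add: s_def[symmetric] algebra_simps)
      qed (use ab in auto)
    qed (use v in auto)
  qed
  then show ?thesis by simp
qed

section \<open>Two large weights with sum at least one\<close>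

text \<open>For \<open>a + b > 1\<close> the two signs of \<open>a\<close> and \<open>b\<close> alone leave the value \<open>2/4\<close> near 0. A third weight
\<open>u \<ge> a + b - 1\<close> brings \<open>\<plusminus>(a + b - u)\<close> back into \<open>[-1, 1]\<close>. Each clause counts the sign patterns that are certainly
successful at \<open>y\<close>.\<close>
lemma third_block_count:
  fixes a b u y :: real
  assumes ab: "0 \<le> b" "b \<le> a" "a \<le> 1" "1 \<le> a + b"
    and u: "a + b - 1 \<le> u" "a - b + u \<le> 1" and y: "0 \<le> y"
  defines "N \<equiv> avg u (avg b (avg a (ind 1))) y"
  shows "y \<le> 1 - (a - b) - u \<Longrightarrow> 5/8 \<le> N"
    and "a + u \<le> 1 \<Longrightarrow> y \<le> 1 - \<bar>a - b - u\<bar> \<Longrightarrow> 5/8 \<le> N"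
    and "y \<le> 1 - \<bar>a - b - u\<bar> \<Longrightarrow> 4/8 \<le> N"
    and "b + u \<le> 1 \<Longrightarrow> u \<le> a \<Longrightarrow> y \<le> 1 + \<bar>a - b - u\<bar> \<Longrightarrow> 4/8 \<le> N"
    and "u \<le> a \<Longrightarrow> y \<le> 1 + (a + b) - u \<Longrightarrow> y \<le> 1 + (a - b) + u \<Longrightarrow> 3/8 \<le> N"
    and "y \<le> 1 + (a + b) - u \<Longrightarrow> 2/8 \<le> N"
    and "y \<le> 1 + (a + b) + u \<Longrightarrow> 1/8 \<le> N"
    and "0 \<le> N"
proof -
  let ?I = "ind 1"
  have N: "8 * N =
    (?I (y + u + b + a) + ?I (y + u + b - a) + ?I (y + u - b + a) + ?I (y + u - b - a)
     + ?I (y - u + b + a) + ?I (y - u + b - a) + ?I (y - u - b + a) + ?I (y - u - b - a))"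
    by (simp add: N_def avg_def field_simps)
  note nn = ind_nonneg[of 1 "y + u + b + a"] ind_nonneg[of 1 "y + u + b - a"]
    ind_nonneg[of 1 "y + u - b + a"] ind_nonneg[of 1 "y + u - b - a"]
    ind_nonneg[of 1 "y - u + b + a"] ind_nonneg[of 1 "y - u + b - a"]
    ind_nonneg[of 1 "y - u - b + a"] ind_nonneg[of 1 "y - u - b - a"]
  have low: "5/8 \<le> N" if "y \<le> 1 - (a - b) - u"
  proof -
    have "?I (y + u - b - a) = 1" "?I (y + u - b + a) = 1" "?I (y - u + b - a) = 1"
      "?I (y - u - b + a) = 1" "?I (y + u + b - a) = 1"
      using ab u y that by (intro ind_1_eq_1; linarith)+
    then show ?thesis using N nn by linarith
  qed
  then show "y \<le> 1 - (a - b) - u \<Longrightarrow> 5/8 \<le> N" .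
  show "5/8 \<le> N" if "a + u \<le> 1" "y \<le> 1 - \<bar>a - b - u\<bar>"
  proof (cases "y \<le> 1 - (a - b) - u")
    case True
    then show ?thesis by (rule low)
  next
    case False
    have "?I (y + u - b - a) = 1" "?I (y - u - b - a) = 1" "?I (y - u + b - a) = 1"
      "?I (y - u - b + a) = 1" "?I (y + u + b - a) = 1"
      using ab u y that False by (intro ind_1_eq_1; linarith)+
    then show ?thesis using N nn by linarith
  qed
  show four: "4/8 \<le> N" if "y \<le> 1 - \<bar>a - b - u\<bar>"
  proof -
    have "?I (y + u - b - a) = 1" "?I (y - u + b - a) = 1"
      "?I (y - u - b + a) = 1" "?I (y + u + b - a) = 1"
      using ab u y that by (intro ind_1_eq_1; linarith)+
    then show ?thesis using N nn by linarith
  qed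
  show "4/8 \<le> N" if "b + u \<le> 1" "u \<le> a" "y \<le> 1 + \<bar>a - b - u\<bar>"
  proof (cases "y \<le> 1 - \<bar>a - b - u\<bar>")
    case True
    then show ?thesis by (rule four)
  next
    case False
    have "?I (y + u - b - a) = 1" "?I (y - u + b - a) = 1" "?I (y - u - b - a) = 1"
      using ab u y that False by (intro ind_1_eq_1; linarith)+
    moreover have "?I (y - u - b + a) = 1 \<or> ?I (y + u + b - a) = 1"
      using ab u y that by (auto simp: ind_def abs_le_iff)
    ultimately show ?thesis using N nn by linarith
  qed
  show two: "2/8 \<le> N" if "y \<le> 1 + (a + b) - u"
  proof (cases "y \<le> 1 - \<bar>a - b - u\<bar>")
    case True
    then show ?thesis using four by linarith
  next
    case False
    have "?I (y + u - b - a) = 1" using ab u y that by (intro ind_1_eq_1; linarith)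
    moreover have "?I (y - u + b - a) = 1 \<or> ?I (y - u - b - a) = 1"
      using ab u y that False by (auto simp: ind_def abs_le_iff)
    ultimately show ?thesis using N nn by linarith
  qed
  show "3/8 \<le> N" if "u \<le> a" "y \<le> 1 + (a + b) - u" "y \<le> 1 + (a - b) + u"
  proof (cases "y \<le> 1 - \<bar>a - b - u\<bar>")
    case True
    then show ?thesis using four by linarith
  next
    case False
    have "?I (y + u - b - a) = 1" "?I (y - u + b - a) = 1"
      using ab u y that False by (intro ind_1_eq_1; linarith)+
    moreover have "?I (y - u - b + a) = 1 \<or> ?I (y + u + b - a) = 1 \<or> ?I (y - u - b - a) = 1"
      using ab u y that False by (auto simp: ind_def abs_le_iff)
    ultimately show ?thesis using N nn by linarith
  qed
  show "1/8 \<le> N" if "y \<le> 1 + (a + b) + u"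
  proof (cases "y \<le> 1 + (a + b) - u")
    case True
    then show ?thesis using two by linarith
  next
    case False
    have "?I (y - u - b - a) = 1" using ab u y that False by (intro ind_1_eq_1; linarith)
    then show ?thesis using N nn by linarith
  qed
  show "0 \<le> N" using N nn by linarith
qed

text \<open>The steps are those of \<open>third_block_count\<close>. If \<open>a + u \<le> 1\<close>, the value \<open>5/8\<close> lasts until \<open>1 - \<bar>a - b - u\<bar>\<close>, otherwise only
until \<open>1 - (a - b) - u\<close>; if \<open>b + u > 1\<close>, there is moreover a gap between two intervals of the value \<open>4/8\<close>, in
which only \<open>3/8\<close> is certain; it begins at \<open>1 + (a - b) - u\<close>.\<close>
lemma third_block_pointwise:
  fixes a b u :: real
  assumes ab: "0 \<le> b" "b \<le> a" "a \<le> 1" "1 \<le> a + b"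
    and u: "a + b - 1 \<le> u" "a - b + u \<le> 1" "u \<le> a" and g: "0 \<le> g" and y: "0 \<le> y"
    and L5: "L \<le> 5/8"
    and L4: "a + u \<le> 1 \<and> L - g * (1 - \<bar>a - b - u\<bar>)\<^sup>2 \<le> 4/8 \<or> L - g * (1 - (a - b) - u)\<^sup>2 \<le> 4/8"
    and gap: "b + u \<le> 1 \<or> L - g * (1 + (a - b) - u)\<^sup>2 \<le> 3/8"
    and L3: "L - g * (1 + \<bar>a - b - u\<bar>)\<^sup>2 \<le> 3/8"
    and L2: "L - g * (1 + (a - b) + u)\<^sup>2 \<le> 2/8"
    and L1: "L - g * (1 + (a + b) - u)\<^sup>2 \<le> 1/8"
    and L0: "L - g * (1 + (a + b) + u)\<^sup>2 \<le> 0"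
  shows "L - g * y\<^sup>2 \<le> avg u (avg b (avg a (ind 1))) y"
proof -
  let ?N = "avg u (avg b (avg a (ind 1))) y"
  note cnt = third_block_count[OF ab u(1,2) y]
  note step = quadratic_step[OF _ _ _ g, where y = y and L = L]
  have gy: "0 \<le> g * y\<^sup>2" using g by simp
  have u0: "0 \<le> u" using ab u by linarith
  consider "y \<le> 1 - (a - b) - u \<or> a + u \<le> 1 \<and> y \<le> 1 - \<bar>a - b - u\<bar>"
    | "\<not> (y \<le> 1 - (a - b) - u \<or> a + u \<le> 1 \<and> y \<le> 1 - \<bar>a - b - u\<bar>)" "y \<le> 1 - \<bar>a - b - u\<bar>"
    | "\<not> (y \<le> 1 - (a - b) - u \<or> a + u \<le> 1 \<and> y \<le> 1 - \<bar>a - b - u\<bar>)"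
      "1 - \<bar>a - b - u\<bar> < y" "y \<le> 1 + \<bar>a - b - u\<bar>"
    | "1 + \<bar>a - b - u\<bar> < y" "y \<le> 1 + (a + b) - u" "y \<le> 1 + (a - b) + u"
    | "1 + (a - b) + u < y" "y \<le> 1 + (a + b) - u"
    | "1 + (a + b) - u < y" "y \<le> 1 + (a + b) + u" | "1 + (a + b) + u < y" by linarith
  then show ?thesis
  proof cases
    case 1
    then have "5/8 \<le> ?N" using cnt(1,2) by blast
    then show ?thesis using gy L5 by linarith
  next
    case 2
    have "4/8 \<le> ?N" using 2 cnt(3) by blast
    moreover have "L - g * y\<^sup>2 \<le> 4/8" using L4
    proof
      assume "L - g * (1 - (a - b) - u)\<^sup>2 \<le> 4/8"
      then show ?thesis using 2 u by (intro step[where t = "1 - (a - b) - u"]) auto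
    qed (use 2 in auto)
    ultimately show ?thesis by linarith
  next
    case 3
    have L4': "L - g * y\<^sup>2 \<le> 4/8" using L4
    proof
      assume "L - g * (1 - (a - b) - u)\<^sup>2 \<le> 4/8"
      then show ?thesis using 3 u by (intro step[where t = "1 - (a - b) - u"]) auto
    next
      assume "a + u \<le> 1 \<and> L - g * (1 - \<bar>a - b - u\<bar>)\<^sup>2 \<le> 4/8"
      then show ?thesis using 3 u ab by (intro step[where t = "1 - \<bar>a - b - u\<bar>"]) auto
    qed
    show ?thesis
    proof (cases "b + u \<le> 1")
      case True
      then show ?thesis using cnt(4) 3 u L4' by linarith
    next
      case False
      have "1 + (a - b) - u \<le> 1 - \<bar>a - b - u\<bar>" using False ab by linarith
      then have "L - g * y\<^sup>2 \<le> 3/8" using False gap 3 u ab u0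
        by (intro step[where t = "1 + (a - b) - u"]) auto
      moreover have "3/8 \<le> ?N" using 3 u ab u0 by (intro cnt(5)) linarith+
      ultimately show ?thesis by linarith
    qed
  next
    case 4
    have "L - g * y\<^sup>2 \<le> 3/8" using 4 by (intro step[OF L3]) auto
    then show ?thesis using cnt(5) 4 u by linarith
  next
    case 5
    have "L - g * y\<^sup>2 \<le> 2/8" using 5 ab u0 by (intro step[OF L2]) auto
    then show ?thesis using cnt(6) 5 u by linarith
  next
    case 6
    have "L - g * y\<^sup>2 \<le> 1/8" using 6 ab u by (intro step[OF L1]) auto
    then show ?thesis using cnt(7) 6 u by linarith
  next
    case 7
    have "L - g * y\<^sup>2 \<le> 0" using 7 ab u0 by (intro step[OF L0]) auto
    then show ?thesis using cnt(8) by linarith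
  qed
qed

text \<open>If \<open>r\<close> lies within the range of the value \<open>5/8\<close>, the induction hypothesis makes a step of height \<open>2/8\<close>
available on top of the value \<open>3/8\<close>.\<close>
lemma third_block_ind_pointwise:
  fixes a b u :: real
  assumes ab: "0 \<le> b" "b \<le> a" "a \<le> 1" "1 \<le> a + b"
    and u: "a + b - 1 \<le> u" "a - b + u \<le> 1" "u \<le> a" and g: "0 \<le> g" and y: "0 \<le> y"
    and r: "r \<le> 1 - (a - b) - u"
    and L2: "1/8 \<le> g * (1 + (a - b) + u)\<^sup>2"
    and L1: "2/8 \<le> g * (1 + (a + b) - u)\<^sup>2"
    and L0: "3/8 \<le> g * (1 + (a + b) + u)\<^sup>2"
  shows "3/8 + 2/8 * ind r y - g * y\<^sup>2 \<le> avg u (avg b (avg a (ind 1))) y"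
proof -
  let ?N = "avg u (avg b (avg a (ind 1))) y"
  note cnt = third_block_count[OF ab u(1,2) y]
  note step = quadratic_step[OF _ _ _ g, where y = y and L = "3/8"]
  have gy: "0 \<le> g * y\<^sup>2" using g by simp
  have u0: "0 \<le> u" using ab u by linarith
  show ?thesis
  proof (cases "y \<le> r")
    case True
    then have "5/8 \<le> ?N" using r by (intro cnt(1)) auto
    then show ?thesis using True y gy by (simp add: ind_def)
  next
    case False
    then have e: "ind r y = 0" using y by (simp add: ind_def)
    consider "y \<le> 1 + (a + b) - u" "y \<le> 1 + (a - b) + u"
      | "1 + (a - b) + u < y" "y \<le> 1 + (a + b) - u"
      | "1 + (a + b) - u < y" "y \<le> 1 + (a + b) + u" | "1 + (a + b) + u < y" by linarith
    then have "3/8 - g * y\<^sup>2 \<le> ?N"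
    proof cases
      case 1
      then show ?thesis using cnt(5) gy u by linarith
    next
      case 2
      have "3/8 - g * y\<^sup>2 \<le> 2/8" using 2 ab u0 L2 by (intro step[where t = "1 + (a - b) + u"]) auto
      then show ?thesis using cnt(6) 2 u by linarith
    next
      case 3
      have "3/8 - g * y\<^sup>2 \<le> 1/8" using 3 ab u L1 by (intro step[where t = "1 + (a + b) - u"]) auto
      then show ?thesis using cnt(7) 3 u by linarith
    next
      case 4
      have "3/8 - g * y\<^sup>2 \<le> 0" using 4 ab u0 L0 by (intro step[where t = "1 + (a + b) + u"]) auto
      then show ?thesis using cnt(8) by linarith
    qed
    then show ?thesis using e by simp
  qed
qed

text \<open>The step function gives \<open>3/8 + 2/8 * 0.46 = 0.49\<close>, which leaves \<open>3/100\<close> for the parabola.\<close>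
lemma rad_ge_third_block_ind:
  fixes a b u :: real
  assumes ab: "0 \<le> b" "b \<le> a" "a \<le> 1" "1 \<le> a + b"
    and u: "a + b - 1 \<le> u" "a - b + u \<le> 1" "u \<le> a" and g: "0 \<le> g"
    and r: "ssq rs \<le> (1 - (a - b) - u)\<^sup>2"
    and L2: "1/8 \<le> g * (1 + (a - b) + u)\<^sup>2"
    and L1: "2/8 \<le> g * (1 + (a + b) - u)\<^sup>2"
    and L0: "3/8 \<le> g * (1 + (a + b) + u)\<^sup>2"
    and gV: "g * ssq rs \<le> 3/100"
    and IH: "0.46 \<le> rad rs (ind (sqrt (ssq rs)))"
  shows "0.46 \<le> rad rs (avg u (avg b (avg a (ind 1))))"
proof -
  have "sqrt (ssq rs) \<le> sqrt ((1 - (a - b) - u)\<^sup>2)" using r by (rule real_sqrt_le_mono)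
  then have "sqrt (ssq rs) \<le> 1 - (a - b) - u" using u by simp
  then have "3/8 + 2/8 * 0.46 - g * ssq rs \<le> rad rs (avg u (avg b (avg a (ind 1))))"
    by (intro rad_ge_quadratic_ind[OF _ third_block_ind_pointwise[OF ab u g _ _ L2 L1 L0] _ IH])
       (auto intro!: even_fun_avg even_fun_ind)
  then show ?thesis using gV by simp
qed

text \<open>The parabola with vertex \<open>L = 46/100 + g V\<close>. In each condition the constant is the distance of 0.46 from the
value of the step function: \<open>33/200\<close> from \<open>5/8\<close>, \<open>1/25\<close> from \<open>4/8\<close>, \<open>17/200\<close> from \<open>3/8\<close>, and so on. The distance
\<open>1 + \<bar>a - b - u\<bar>\<close> at which the value \<open>4/8\<close> ends is estimated by 1.\<close>
lemma rad_ge_third_block: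
  fixes a b u :: real
  assumes ab: "0 \<le> b" "b \<le> a" "a \<le> 1" "1 \<le> a + b"
    and u: "a + b - 1 \<le> u" "a - b + u \<le> 1" "u \<le> a" and g: "0 \<le> g" and V: "ssq rs \<le> V"
    and c5: "g * V \<le> 33/200"
    and c4: "a + u \<le> 1 \<and> g * (V - (1 - \<bar>a - b - u\<bar>)\<^sup>2) \<le> 1/25 \<or> g * (V - (1 - (a - b) - u)\<^sup>2) \<le> 1/25"
    and gap: "b + u \<le> 1 \<or> 17/200 \<le> g * ((1 + (a - b) - u)\<^sup>2 - V)"
    and c3: "17/200 \<le> g * (1 - V)"
    and c2: "21/100 \<le> g * ((1 + (a - b) + u)\<^sup>2 - V)"
    and c1: "67/200 \<le> g * ((1 + (a + b) - u)\<^sup>2 - V)"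
    and c0: "23/50 \<le> g * ((1 + (a + b) + u)\<^sup>2 - V)"
  shows "0.46 \<le> rad rs (avg u (avg b (avg a (ind 1))))"
proof (rule rad_ge_quadratic_even[where L = "46/100 + g * V", OF _ _ g V])
  fix y :: real assume y: "0 \<le> y"
  have "1\<^sup>2 \<le> (1 + \<bar>a - b - u\<bar>)\<^sup>2" by (intro power_mono) auto
  then have "g * 1 \<le> g * (1 + \<bar>a - b - u\<bar>)\<^sup>2" using g by (intro mult_left_mono) auto
  then have c3': "46/100 + g * V - g * (1 + \<bar>a - b - u\<bar>)\<^sup>2 \<le> 3/8"
    using c3 unfolding right_diff_distrib by linarith
  have c4': "a + u \<le> 1 \<and> 46/100 + g * V - g * (1 - \<bar>a - b - u\<bar>)\<^sup>2 \<le> 4/8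
      \<or> 46/100 + g * V - g * (1 - (a - b) - u)\<^sup>2 \<le> 4/8"
  proof -
    have "46/100 + g * V - g * t \<le> 4/8" if "g * (V - t) \<le> 1/25" for t
      using that unfolding right_diff_distrib by linarith
    then show ?thesis using c4 by blast
  qed
  have gap': "b + u \<le> 1 \<or> 46/100 + g * V - g * (1 + (a - b) - u)\<^sup>2 \<le> 3/8"
    using gap unfolding right_diff_distrib by linarith
  show "46/100 + g * V - g * y\<^sup>2 \<le> avg u (avg b (avg a (ind 1))) y"
    by (rule third_block_pointwise[OF ab u g y _ c4' gap' c3'];
        use c5 c2 c1 c0 in \<open>simp only: right_diff_distrib; linarith\<close>)
qed (auto intro!: even_fun_avg even_fun_ind)

text \<open>The value \<open>2/4\<close> lasts until \<open>1 + (a - b)\<close>, and \<open>g\<close> is chosen such that the parabola with vertex \<open>1/2\<close> has fallen to \<open>1/4\<close> at that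
point. Its loss is at most \<open>16/100 * 1/4 = 1/25\<close>.\<close>
lemma rad_ge_pair_small_tail:
  fixes a b :: real
  assumes ab: "0 \<le> b" "b \<le> a" "1 \<le> a + b" "a \<le> 353/500"
    and V: "ssq as \<le> 16/100 * (1 + (a - b))\<^sup>2"
  shows "0.46 \<le> rad as (avg b (avg a (ind 1)))"
proof -
  let ?I = "ind 1"
  define g where "g = 1 / (4 * (1 + (a - b))\<^sup>2)"
  have p: "0 < (1 + (a - b))\<^sup>2" using ab by simp
  have g: "0 \<le> g" "g * (1 + (a - b))\<^sup>2 = 1/4" using p by (auto simp: g_def field_simps)
  have "g * (16/100 * (1 + (a - b))\<^sup>2) = 1/25" using g by simp
  moreover have "1/2 \<le> g * (1 + (a + b))\<^sup>2"
  proof -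
    have "(1 + (a - b))\<^sup>2 \<le> (353/250)\<^sup>2" "2\<^sup>2 \<le> (1 + (a + b))\<^sup>2" using ab by (intro power_mono; linarith)+
    then have "2 * (1 + (a - b))\<^sup>2 \<le> (1 + (a + b))\<^sup>2" by (simp add: power_divide)
    then have "g * (2 * (1 + (a - b))\<^sup>2) \<le> g * (1 + (a + b))\<^sup>2" using g by (intro mult_left_mono)
    then show ?thesis using g by simp
  qed
  moreover have "1/2 - g * y\<^sup>2 \<le> avg b (avg a ?I) y" if y: "0 \<le> y" for y
  proof -
    have N: "4 * avg b (avg a ?I) y = ?I (y + b + a) + ?I (y + b - a) + ?I (y - b + a) + ?I (y - b - a)"
      by (simp add: avg_def field_simps)
    note nn = ind_nonneg[of 1 "y + b + a"] ind_nonneg[of 1 "y + b - a"]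
      ind_nonneg[of 1 "y - b + a"] ind_nonneg[of 1 "y - b - a"]
    note step = quadratic_step[OF _ _ _ g(1), where y = y and L = "1/2"]
    have gy: "0 \<le> g * y\<^sup>2" using g by simp
    consider "y \<le> 1 + (a - b)" | "1 + (a - b) < y" "y \<le> 1 + (a + b)" | "1 + (a + b) < y" by linarith
    then show ?thesis
    proof cases
      case 1
      have "?I (y + b - a) = 1" using ab y 1 by (intro ind_1_eq_1; linarith)
      moreover have "?I (y - b + a) = 1 \<or> ?I (y - b - a) = 1"
        using ab y 1 by (auto simp: ind_def abs_le_iff)
      ultimately show ?thesis using N nn gy by linarith
    next
      case 2
      have "?I (y - b - a) = 1" using ab y 2 by (intro ind_1_eq_1; linarith)
      moreover have "1/2 - g * y\<^sup>2 \<le> 1/4" using 2 ab g by (intro step[where t = "1 + (a - b)"]) auto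
      ultimately show ?thesis using N nn by linarith
    next
      case 3
      have "1/2 - g * y\<^sup>2 \<le> 0" using 3 ab \<open>1/2 \<le> g * (1 + (a + b))\<^sup>2\<close>
        by (intro step[where t = "1 + (a + b)"]) auto
      then show ?thesis using N nn by linarith
    qed
  qed
  ultimately show ?thesis
    by (intro rad_ge_quadratic_even[where L = "1/2", OF _ _ g(1) V]) (auto intro!: even_fun_avg even_fun_ind)
qed

text \<open>A third weight is obtained as a single remaining weight or as a stopped block. It has to be at least
\<open>s - 1\<close> for \<open>s = a + b\<close>, so that \<open>a + b - u \<le> 1\<close>, and at least \<open>1/10\<close> so that the drops of the step
function at \<open>1 - \<bar>a - b - u\<bar>\<close> and \<open>1 + (a - b) + u\<close> come late enough. The cases follow the shape of the step function: \<open>a + u \<le> 1\<close>; then \<open>a + u > 1\<close> but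
\<open>b + u \<le> 1\<close>; and \<open>b + u > 1\<close>, where the remaining variance is so small that the induction hypothesis, or a
steep parabola, applies. If the rest has small variance to begin with, no third weight is needed.\<close>
lemma rad_ge_long_pair:
  fixes a b :: real
  assumes ss: "ssq (a # b # as) = 1" and ab: "0 \<le> b" "b \<le> a" "a \<le> 353/500" "1 \<le> a + b"
    and as: "\<And>w. w \<in> set as \<Longrightarrow> 0 \<le> w \<and> w \<le> b"
    and IH: "\<And>rs. length rs \<le> length as \<Longrightarrow> 0.46 \<le> rad rs (ind (sqrt (ssq rs)))"
  shows "0.46 \<le> rad (a # b # as) (ind 1)"
proof -
  let ?N = "avg b (avg a (ind 1))"
  define s d v where "s = a + b" and "d = a - b" and "v = 1 - (s\<^sup>2 + d\<^sup>2) / 2"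
  have sd: "a + b = s" "a - b = d" by (simp_all add: s_def d_def)
  have ba: "2 * b = s - d" "2 * a = s + d" by (simp_all add: s_def d_def)
  have vab: "v = 1 - a\<^sup>2 - b\<^sup>2" by (simp add: v_def s_def d_def power2_eq_square field_simps)
  then have v: "ssq as = v" using ss by simp
  have s1: "1 \<le> s" and d0: "0 \<le> d" and sdle: "s + d \<le> 353/250" and a2: "1/2 \<le> a" "a \<le> 1"
    using ab by (auto simp: s_def d_def)
  have s1sq: "1 \<le> s\<^sup>2" using s1 by simp
  have vd: "v \<le> 1/2 - d\<^sup>2 / 2" using s1sq unfolding v_def add_divide_distrib by linarith
  have vhalf: "v \<le> 1/2" using vd zero_le_power2[of d] by linarith
  have e2: "even_fun ?N" by (intro even_fun_avg even_fun_ind)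
  \<comment> \<open>With slope \<open>g = 3/10\<close> the condition at the end of the value \<open>5/8\<close> is a bound by \<open>2/15 = 1/25 / g\<close>.\<close>
  have near: "v - (1 - (d - u))\<^sup>2 \<le> 2/15" if "1/10 \<le> u" for u
  proof -
    have "(11/10 - d)\<^sup>2 \<le> (1 - (d - u))\<^sup>2" using that sdle s1 by (intro power_mono) auto
    moreover have "(11/10 - d)\<^sup>2 = 121/100 - 11/5 * d + d\<^sup>2" "(d - 11/15)\<^sup>2 = d\<^sup>2 - 22/15 * d + 121/225"
      by (simp_all add: power2_eq_square field_simps)
    ultimately show ?thesis using vd zero_le_power2[of "d - 11/15"] by linarith
  qed
  have blockA: "0.46 \<le> rad rs (avg u ?N)"
    if rs: "ssq rs \<le> V" and V: "V \<le> v" and u: "a + u \<le> 1" "s - 1 \<le> u" "1/10 \<le> u"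
      and far: "d < u \<Longrightarrow> V - (1 - (u - d))\<^sup>2 \<le> 2/15" for rs u V
  proof -
    have c4: "V - (1 - \<bar>d - u\<bar>)\<^sup>2 \<le> 2/15"
    proof (cases "d < u")
      case True
      then show ?thesis using far by (simp add: abs_if algebra_simps)
    next
      case False
      then show ?thesis using near[OF u(3)] V by (simp add: abs_if)
    qed
    have "(11/10)\<^sup>2 \<le> (1 + d + u)\<^sup>2" "(3/2)\<^sup>2 \<le> (1 + s - u)\<^sup>2" "2\<^sup>2 \<le> (1 + s + u)\<^sup>2"
      using u s1 d0 a2 by (intro power_mono; linarith)+
    moreover have u': "a - b + u \<le> 1" "u \<le> a" using u a2 ab by linarith+
    ultimately show ?thesis
      using c4 vhalf V u ab
      by (intro rad_ge_third_block[where g = "3/10" and V = V, OF ab(1,2) a2(2) ab(4) _ u' _ rs])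
         (simp_all add: sd power_divide)
  qed
  show ?thesis
  proof (cases "v \<le> 16/100 * (1 + d)\<^sup>2")
    case True
    then have "ssq as \<le> 16/100 * (1 + (a - b))\<^sup>2" using v sd by simp
    from rad_ge_pair_small_tail[OF ab(1,2,4,3) this] show ?thesis by simp
  next
    case False
    \<comment> \<open>Since \<open>v\<close> is not small, \<open>s\<close> is not large.\<close>
    then have K: "s\<^sup>2 \<le> 168/100 - 64/100 * d - 132/100 * d\<^sup>2"
      by (simp add: v_def power2_eq_square field_simps)
    have s13: "s \<le> 1297/1000"
    proof (rule ccontr)
      assume "\<not> s \<le> 1297/1000"
      then have "(1297/1000)\<^sup>2 \<le> s\<^sup>2" by (intro power_mono) auto
      then show False using K d0 zero_le_power2[of d] by (simp add: power_divide)
    qed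
    define l where "l = max (s - 1) (1/10)"
    have l: "0 < l" "s - 1 \<le> l" "1/10 \<le> l" by (auto simp: l_def)
    have "0.46 \<le> rad as ?N"
    proof (cases "\<exists>w \<in> set as. l \<le> w")
      case True
      then obtain w where w: "w \<in> set as" "l \<le> w" by blast
      obtain rs where rs: "mset as = mset (w # rs)" "set rs \<subseteq> set as" "length rs \<le> length as"
        "ssq as = w\<^sup>2 + ssq rs"
        by (rule rad_move_front[OF w(1)])
      define V where "V = v - w\<^sup>2"
      have V: "ssq rs = V" using rs(4) v by (simp add: V_def)
      have Vle: "V \<le> v" by (simp add: V_def)
      have wb: "w \<le> b" using as w by auto
      have w0: "s - 1 \<le> w" "1/10 \<le> w" using w l by auto
      have "0.46 \<le> rad rs (avg w ?N)"
      proof (cases "a + w \<le> 1")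
        case True
        show ?thesis
        proof (rule blockA[OF _ Vle True w0])
          assume "d < w"
          have "(1 - w)\<^sup>2 \<le> (1 - (w - d))\<^sup>2" using True d0 a2 by (intro power_mono) auto
          moreover have "(1 - w)\<^sup>2 = 1 - 2 * w + w\<^sup>2" "(w - 1/2)\<^sup>2 = w\<^sup>2 - w + 1/4"
            by (simp_all add: power2_eq_square field_simps)
          ultimately show "V - (1 - (w - d))\<^sup>2 \<le> 2/15"
            using vhalf zero_le_power2[of "w - 1/2"] unfolding V_def by linarith
        qed (use V in simp)
      next
        case False
        have wa: "w \<le> a" using wb ab by linarith
        have dw: "a - b + w \<le> 1" using wb a2 by linarith
        have w0': "a + b - 1 \<le> w" using w0 sd by simp
        show ?thesis
        proof (cases "b + w \<le> 1")
          case True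
          \<comment> \<open>Since \<open>w\<close> and \<open>b\<close> both exceed \<open>1 - a\<close>, little variance is left.\<close>
          have "(1 - a)\<^sup>2 \<le> w\<^sup>2" "(1 - a)\<^sup>2 \<le> b\<^sup>2" using False wb a2 by (auto intro!: power_mono)
          then have V2: "V \<le> 1 - a\<^sup>2 - 2 * (1 - a)\<^sup>2" unfolding V_def vab by linarith
          have q: "(1 - a)\<^sup>2 = 1 - 2 * a + a\<^sup>2" "(a - 2/3)\<^sup>2 = a\<^sup>2 - 4/3 * a + 4/9"
            "(a - 3/4)\<^sup>2 = a\<^sup>2 - 3/2 * a + 9/16"
            by (simp_all add: power2_eq_square field_simps)
          have V3: "V \<le> 1/3" using V2 q zero_le_power2[of "a - 2/3"] by linarith
          have r: "(1 - a)\<^sup>2 \<le> (1 - d - w)\<^sup>2" using wb a2 by (intro power_mono) (auto simp: d_def)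
          have Vr: "V - (1 - d - w)\<^sup>2 \<le> 1/4 - 4 * (a - 3/4)\<^sup>2" using V2 r q by linarith
          show ?thesis
          proof (cases "a \<le> 58/100")
            case True
            have "(17/100)\<^sup>2 \<le> (3/4 - a)\<^sup>2" using True by (intro power_mono) auto
            then have "V - (1 - d - w)\<^sup>2 \<le> 16/100"
              using Vr by (simp add: power2_commute[of a] power_divide)
            moreover have "(142/100)\<^sup>2 \<le> (1 + d + w)\<^sup>2" "(3/2)\<^sup>2 \<le> (1 + s - w)\<^sup>2" "2\<^sup>2 \<le> (1 + s + w)\<^sup>2"
              using False True d0 s1 wb a2 by (intro power_mono; simp add: s_def)+
            ultimately show ?thesis
              using V3 \<open>b + w \<le> 1\<close>
              by (intro rad_ge_third_block[where g = "1/4" and V = V, OF ab(1,2) a2(2) ab(4) w0' dw wa])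
                 (simp_all add: sd V power_divide)
          next
            case False
            have "V - (1 - d - w)\<^sup>2 \<le> 1/4" using Vr zero_le_power2[of "a - 3/4"] by linarith
            moreover have "(1294/1000)\<^sup>2 \<le> (1 + d + w)\<^sup>2" "(158/100)\<^sup>2 \<le> (1 + s - w)\<^sup>2" "2\<^sup>2 \<le> (1 + s + w)\<^sup>2"
              using \<open>\<not> a + w \<le> 1\<close> False d0 s1 wb ab by (intro power_mono; simp add: s_def)+
            ultimately show ?thesis
              using V3 \<open>b + w \<le> 1\<close>
              by (intro rad_ge_third_block[where g = "4/25" and V = V, OF ab(1,2) a2(2) ab(4) w0' dw wa])
                 (simp_all add: sd V power_divide)
          qed
        next
          case bw: False
          \<comment> \<open>Here \<open>V \<le> (1 - d - w)\<^sup>2\<close>, so the standard deviation of the rest lies in the range of the value \<open>5/8\<close>.\<close>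
          define p where "p = d * (w + b - 1)"
          have "0 \<le> p" unfolding p_def using bw d0 by (intro mult_nonneg_nonneg) auto
          moreover have "0 \<le> w\<^sup>2 + b\<^sup>2 - w"
          proof (cases "1/2 \<le> w")
            case True
            have "0 \<le> w * (2 * w - 1)" using True by (intro mult_nonneg_nonneg) auto
            moreover have "w\<^sup>2 \<le> b\<^sup>2" using True wb by (intro power_mono) auto
            ultimately show ?thesis by (simp add: power2_eq_square algebra_simps)
          next
            case False
            have "0 \<le> (1 - 2 * w) * (1 - w)" using False by (intro mult_nonneg_nonneg) auto
            moreover have "(1 - w)\<^sup>2 \<le> b\<^sup>2" using False bw by (intro power_mono) auto
            ultimately show ?thesis by (simp add: power2_eq_square algebra_simps)
          qed
          moreover have "(1 - d - w)\<^sup>2 - V = 2 * d\<^sup>2 + 2 * (w\<^sup>2 + b\<^sup>2 - w) + 2 * p"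
            by (simp add: p_def V_def vab d_def power2_eq_square algebra_simps)
          ultimately have "0 \<le> (1 - d - w)\<^sup>2 - V" by simp
          then have r: "V \<le> (1 - d - w)\<^sup>2" by simp
          have "0 \<le> (b - 1/2) * (3 * b - 1/2)" using bw wb by (intro mult_nonneg_nonneg) auto
          moreover have "(1 - b)\<^sup>2 \<le> w\<^sup>2" "b\<^sup>2 \<le> a\<^sup>2" using bw ab a2 by (auto intro!: power_mono)
          moreover have "(1 - b)\<^sup>2 = 1 - 2 * b + b\<^sup>2" "(b - 1/2) * (3 * b - 1/2) = 3 * b\<^sup>2 - 2 * b + 1/4"
            by (simp_all add: power2_eq_square field_simps)
          ultimately have "V \<le> 1/4" unfolding V_def vab by linarith
          moreover have "(129/100)\<^sup>2 \<le> (1 + d + w)\<^sup>2" "(3/2)\<^sup>2 \<le> (1 + s - w)\<^sup>2" "2\<^sup>2 \<le> (1 + s + w)\<^sup>2"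
            using bw d0 s1 wb ab a2 by (intro power_mono; simp add: s_def)+
          ultimately show ?thesis
            using r IH[OF rs(3)]
            by (intro rad_ge_third_block_ind[where g = "1/9", OF ab(1,2) a2(2) ab(4) w0' dw wa])
               (simp_all add: sd V power_divide)
        qed
      qed
      then show ?thesis using rad_perm[OF rs(1)] by simp
    next
      case False
      show ?thesis
      proof (rule rad_block[OF e2 l(1)])
        fix w assume "w \<in> set as"
        then show "0 \<le> w \<and> w \<le> 2 * l" using as False l by force
      next
        fix y :: real assume y: "\<bar>y\<bar> < l"
        \<comment> \<open>As long as \<open>\<bar>y\<bar> < l\<close>, the two patterns with opposite signs succeed.\<close>
        have "l \<le> 1 - (a - b)" using s1 sdle s13 sd by (auto simp: l_def)
        then have "ind 1 (y + b - a) = 1" "ind 1 (y - b + a) = 1"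
          using y ab by (intro ind_1_eq_1; linarith)+
        moreover have "4 * ?N y = ind 1 (y + b + a) + ind 1 (y + b - a) + ind 1 (y - b + a) + ind 1 (y - b - a)"
          by (simp add: avg_def field_simps)
        ultimately show "0.46 \<le> ?N y"
          using ind_nonneg[of 1 "y + b + a"] ind_nonneg[of 1 "y - b - a"] by simp
      next
        fix u rs
        assume u: "l \<le> u" "u \<le> 2 * l" and len: "length rs \<le> length as" and "ssq rs + (u - l)\<^sup>2 \<le> ssq as"
        then have V: "ssq rs + (u - l)\<^sup>2 \<le> v" using v by simp
        then have Vv: "ssq rs \<le> v" using zero_le_power2[of "u - l"] by linarith
        have u1: "s - 1 \<le> u" "1/10 \<le> u" using u l by auto
        show "0.46 \<le> rad rs (avg u ?N)"
        proof (cases "a + u \<le> 1")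
          case True
          show ?thesis
          proof (rule blockA[OF Vv order_refl True u1])
            have lu: "(1 - u)\<^sup>2 \<le> (1 - (u - d))\<^sup>2" using True d0 a2 by (intro power_mono) auto
            show "v - (1 - (u - d))\<^sup>2 \<le> 2/15"
            proof (cases "s \<le> 11/10")
              case True
              then have "(4/5)\<^sup>2 \<le> (1 - u)\<^sup>2" using u by (intro power_mono) (auto simp: l_def)
              then show ?thesis using lu vhalf by (simp add: power_divide)
            next
              case False
              then have "(3 - 2 * s)\<^sup>2 \<le> (1 - u)\<^sup>2" using u s13 by (intro power_mono) (auto simp: l_def)
              moreover have "(3 - 2 * s)\<^sup>2 = 9 - 12 * s + 4 * s\<^sup>2" "(s - 4/3)\<^sup>2 = s\<^sup>2 - 8/3 * s + 16/9"
                by (simp_all add: power2_eq_square field_simps)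
              moreover have "v \<le> 1 - s\<^sup>2 / 2"
                using zero_le_power2[of d] unfolding v_def add_divide_distrib by linarith
              ultimately show ?thesis using lu zero_le_power2[of "s - 4/3"] by linarith
            qed
          qed
        next
          case au: False
          \<comment> \<open>The level is not \<open>1/10\<close> because then \<open>u \<le> 1/5\<close> and \<open>a + u \<le> 1\<close>.\<close>
          then have ls: "l = s - 1" using u ab unfolding l_def by linarith
          have us: "u \<le> 2 * s - 2" using u ls by simp
          have ua: "u \<le> a" using us s13 ba d0 by linarith
          have du: "a - b + u \<le> 1" using us s13 sdle sd by linarith
          have u1': "a + b - 1 \<le> u" using u1 sd by simp
          show ?thesis
          proof (cases "b + u \<le> 1")
            case True
            have "(3 - 2 * s - d)\<^sup>2 \<le> (1 - d - u)\<^sup>2" using us s13 sdle by (intro power_mono) auto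
            moreover define p q where "p = (353/250 - s - d) * (441/250 - s)" and "q = (353/250 - s - d)\<^sup>2"
            have "0 \<le> q" by (simp add: q_def)
            moreover have "0 \<le> p" unfolding p_def
              using sdle s13 by (intro mult_nonneg_nonneg) auto
            moreover have "(3 - 2 * s - d)\<^sup>2 - v + 2/15 = 2 * (s - 1147/1000)\<^sup>2 + p
                + 3/2 * q + (2521744/1000000 + 996872/1000000 - 1 + 2/15 - 2 * (1147/1000)\<^sup>2)"
              by (simp add: p_def q_def v_def power2_eq_square field_simps)
            moreover have "0 \<le> (2521744/1000000 + 996872/1000000 - 1 + 2/15 - 2 * (1147/1000)\<^sup>2 :: real)"
              by (simp add: power_divide)
            ultimately have "v - (1 - d - u)\<^sup>2 \<le> 2/15"
              using zero_le_power2[of "s - 1147/1000"] by linarith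
            moreover have "(11/10)\<^sup>2 \<le> (1 + d + u)\<^sup>2" "(3/2)\<^sup>2 \<le> (1 + s - u)\<^sup>2" "2\<^sup>2 \<le> (1 + s + u)\<^sup>2"
              using u1 us s13 d0 s1 by (intro power_mono; linarith)+
            ultimately show ?thesis
              using vhalf True
              by (intro rad_ge_third_block[where g = "3/10" and V = v, OF ab(1,2) a2(2) ab(4) u1' du ua _ Vv])
                 (simp_all add: sd power_divide)
          next
            case bu: False
            have s12: "6/5 + d/5 \<le> s" using bu us ba by linarith
            \<comment> \<open>The variance used up by the overshoot matters in this case.\<close>
            define V where "V = v - (u - (s - 1))\<^sup>2"
            have rsV: "ssq rs \<le> V" using V by (simp add: V_def ls)
            have "(6/5)\<^sup>2 \<le> s\<^sup>2" using s12 d0 by (intro power_mono) auto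
            then have "36/25 \<le> s\<^sup>2" by (simp add: power_divide)
            then have V28: "V \<le> 28/100"
              using zero_le_power2[of d] zero_le_power2[of "u - (s - 1)"]
              unfolding V_def v_def add_divide_distrib by linarith
            have un: "294/1000 \<le> u" using bu ab by linarith
            have s127: "s \<le> 127/100" if "9/100 \<le> d"
            proof (rule ccontr)
              assume "\<not> s \<le> 127/100"
              then have "(127/100)\<^sup>2 \<le> s\<^sup>2" by (intro power_mono) auto
              moreover have "(9/100)\<^sup>2 \<le> d\<^sup>2" using that by (intro power_mono) auto
              ultimately show False using K that by (simp add: power_divide)
            qed
            define p where "p = (2 * s - 2 - u) * (2 - s - d - u)"
            have "0 \<le> p" unfolding p_def
            proof (rule mult_nonneg_nonneg)
              show "0 \<le> 2 - s - d - u" using us s13 s127 sdle by (cases "d \<le> 9/100") auto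
            qed (use us in simp)
            moreover have "V - (1 - d - u)\<^sup>2 = - 9 + 14 * s - 11/2 * s\<^sup>2 + 6 * d - 4 * (s * d) - 3/2 * d\<^sup>2
                - 2 * p"
              by (simp add: p_def V_def v_def power2_eq_square field_simps)
            moreover have "(6/5 + d/5) * d \<le> s * d" using s12 d0 by (rule mult_right_mono)
            moreover have "(6/5 + d/5) * d = 6/5 * d + d\<^sup>2 / 5" "(s - 14/11)\<^sup>2 = s\<^sup>2 - 28/11 * s + 196/121"
              by (simp_all add: power2_eq_square field_simps)
            ultimately have h: "V - (1 - d - u)\<^sup>2 \<le> - (1/11) + 6/5 * d - 23/10 * d\<^sup>2"
              using zero_le_power2[of "s - 14/11"] by linarith
            show ?thesis
            proof (cases "d \<le> 9/100")
              case True
              have "0 \<le> (9/100 - d) * (6/5 - 23/10 * (9/100 + d))" using True d0 by (intro mult_nonneg_nonneg) auto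
              moreover have "(9/100 - d) * (6/5 - 23/10 * (9/100 + d)) = 108/1000 - 6/5 * d - 23/10 * (81/10000) + 23/10 * d\<^sup>2"
                by (simp add: power2_eq_square field_simps)
              ultimately have "ssq rs \<le> (1 - d - u)\<^sup>2" using h rsV by linarith
              moreover have "(129/100)\<^sup>2 \<le> (1 + d + u)\<^sup>2" "(17/10)\<^sup>2 \<le> (1 + s - u)\<^sup>2" "2\<^sup>2 \<le> (1 + s + u)\<^sup>2"
                using un us s13 d0 s1 by (intro power_mono; linarith)+
              ultimately show ?thesis
                using V28 rsV IH[OF len]
                by (intro rad_ge_third_block_ind[where g = "1/10", OF ab(1,2) a2(2) ab(4) u1' du ua])
                   (simp_all add: sd power_divide)
            next
              case False
              have d9: "9/100 \<le> d" using False by simp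
              have "(d - 26/100)\<^sup>2 = d\<^sup>2 - 52/100 * d + 676/10000" by (simp add: power2_eq_square field_simps)
              then have c4: "V - (1 - d - u)\<^sup>2 \<le> 7/100"
                using h zero_le_power2[of "d - 26/100"] sdle s1 by linarith
              define p where "p = d * (54/100 - u)"
              have "0 \<le> p" unfolding p_def using us s127[OF d9] d0 by (intro mult_nonneg_nonneg) auto
              moreover have "(1 + d - u)\<^sup>2 = (1 - d - u)\<^sup>2 + 4 * (46/100 * d) + 4 * p"
                by (simp add: p_def power2_eq_square field_simps)
              moreover have "(9/100)\<^sup>2 \<le> d\<^sup>2" using d9 by (intro power_mono) auto
              ultimately have gap: "16/100 \<le> (1 + d - u)\<^sup>2 - V" using h d9 by (simp add: power_divide)
              have "(129/100)\<^sup>2 \<le> (1 + d + u)\<^sup>2" "(17/10)\<^sup>2 \<le> (1 + s - u)\<^sup>2" "2\<^sup>2 \<le> (1 + s + u)\<^sup>2"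
                using un us s13 d0 s1 by (intro power_mono; linarith)+
              then show ?thesis
                using V28 c4 gap
                by (intro rad_ge_third_block[where g = "11/20" and V = V, OF ab(1,2) a2(2) ab(4) u1' du ua _ rsV])
                   (simp_all add: sd power_divide)
            qed
          qed
        qed
      qed
    qed
    then show ?thesis by simp
  qed
qed

section \<open>All weights\<close>

text \<open>Induction on the number of weights. Rescaling a proper part of the list to unit variance turns the induction
hypothesis into a statement about its standard deviation; this is how the cases with two large
weights use it.\<close>
theorem rad_ge:
  assumes "ssq as = 1"
  shows "0.46 \<le> rad as (ind 1)"
  using assms
proof (induction "length as" arbitrary: as rule: less_induct)
  case less
  have IH: "0.46 \<le> rad rs (ind (sqrt (ssq rs)))" if "length rs < length as" for rs
  proof (cases "ssq rs = 0")
    case True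
    then show ?thesis by (simp add: rad_zero_weights ind_def)
  next
    case False
    define c where "c = sqrt (ssq rs)"
    have c: "0 < c" using False ssq_nonneg[of rs] by (simp add: c_def)
    have c2: "c\<^sup>2 = ssq rs" using ssq_nonneg[of rs] by (simp add: c_def)
    have "ssq (map ((*) (1 / c)) rs) = 1"
    proof -
      have "ssq (map ((*) (1 / c)) rs) = (1 / c)\<^sup>2 * ssq rs"
        by (induction rs) (simp_all add: power_divide add_divide_distrib)
      then show ?thesis using c by (simp add: power_divide flip: c2)
    qed
    then have "0.46 \<le> rad (map ((*) (1 / c)) rs) (ind 1)" using that by (intro less.hyps) simp_all
    also have "\<dots> = rad rs (\<lambda>x. ind 1 (1 / c * x))" by (rule rad_rescale)
    also have "(\<lambda>x. ind 1 (1 / c * x)) = ind c" using c by (auto simp: ind_def fun_eq_iff field_simps)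
    finally show ?thesis by (simp add: c_def)
  qed
  \<comment> \<open>Passing to absolute values in decreasing order.\<close>
  define bs where "bs = rev (sort (map abs as))"
  have m: "mset bs = mset (map abs as)" by (simp add: bs_def)
  have eq: "rad as (ind 1) = rad bs (ind 1)" using rad_perm[OF m] rad_abs by simp
  have "ssq bs = ssq (map abs as)"
    using arg_cong[OF m, of "\<lambda>M. \<Sum>a\<in>#M. a\<^sup>2"] by (simp add: multiset.map_comp flip: sum_mset_sum_list)
  then have ss: "ssq bs = 1" using less.prems by (simp add: o_def)
  have len: "length bs = length as" by (simp add: bs_def)
  have dec: "sorted_wrt (\<ge>) bs" by (simp add: bs_def sorted_wrt_rev)
  have nn: "\<forall>x \<in> set bs. 0 \<le> x" by (auto simp: bs_def)
  obtain a cs where bs: "bs = a # cs" using ss by (cases bs) auto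
  have a: "0 \<le> a" "\<And>x. x \<in> set cs \<Longrightarrow> 0 \<le> x \<and> x \<le> a" using nn dec bs by auto
  consider "a \<le> 3/8" | "3/8 \<le> a" "a < 353/500" | "353/500 \<le> a" by linarith
  then have "0.46 \<le> rad bs (ind 1)"
  proof cases
    case 1
    have "0 \<le> x \<and> x \<le> 3/8" if "x \<in> set bs" for x using that a 1 bs by fastforce
    then show ?thesis by (rule rad_ge_small_weights[OF ss])
  next
    case 2
    have "cs \<noteq> []"
    proof
      assume "cs = []"
      then have "a\<^sup>2 = 1" using ss bs by simp
      moreover have "a\<^sup>2 \<le> (353/500)\<^sup>2" using a(1) 2 by (intro power_mono) auto
      ultimately show False by (simp add: power_divide)
    qed
    then obtain b ds where cs: "cs = b # ds" by (cases cs) auto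
    have b: "0 \<le> b" "b \<le> a" "\<And>x. x \<in> set ds \<Longrightarrow> 0 \<le> x \<and> x \<le> b" using nn dec bs cs by auto
    have ssb: "ssq (a # b # ds) = 1" using ss bs cs by simp
    have IHd: "0.46 \<le> rad rs (ind (sqrt (ssq rs)))" if "length rs \<le> length ds" for rs
      using that len bs cs by (intro IH) simp
    show ?thesis
    proof (cases "b \<le> 7/25")
      case True
      then have small: "0 \<le> x \<and> x \<le> 7/25" if "x \<in> set cs" for x
        using b that by (auto simp: cs dest: b(3))
      show ?thesis
      proof (cases "a \<le> 14/25")
        case True
        then show ?thesis
          using rad_ge_one_large_weight[OF ss[unfolded bs] a(1) True small] bs by simp
      next
        case False
        then show ?thesis
          using rad_ge_three_blocks[OF ss[unfolded bs] _ _ small] 2 bs by simp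
      qed
    next
      case False
      show ?thesis
      proof (cases "a + b \<le> 1")
        case True
        have "0.46 \<le> rad (a # b # ds) (ind 1)"
          using 2 False b(2) True IHd[of ds] by (intro rad_ge_short_pair[OF ssb]) simp_all
        then show ?thesis using bs cs by simp
      next
        case ab: False
        have "0.46 \<le> rad (a # b # ds) (ind 1)"
          by (rule rad_ge_long_pair[OF ssb b(1,2) _ _ b(3) IHd]) (use 2 ab in auto)
        then show ?thesis using bs cs by simp
      qed
    qed
  next
    case 3
    then show ?thesis using rad_ge_dominant_weight[OF ss[unfolded bs]] bs by simp
  qed
  then show ?case using eq by simp
qed

section \<open>Random signs\<close>

text \<open>By induction on the number of terms: the last sign is independent of the sum of the others, so
integrating it out replaces \<open>f\<close> by its average over two shifts. The list is reversed because the head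
of the list is the sign that is averaged first.\<close>
lemma (in prob_space) expectation_signed_sum:
  fixes a :: "nat \<Rightarrow> real" and X :: "nat \<Rightarrow> 'a \<Rightarrow> real"
  assumes indep: "indep_vars (\<lambda>_. borel) X {1..n}"
    and plus: "\<And>i. i \<in> {1..n} \<Longrightarrow> prob {\<omega> \<in> space M. X i \<omega> = 1} = 1/2"
    and minus: "\<And>i. i \<in> {1..n} \<Longrightarrow> prob {\<omega> \<in> space M. X i \<omega> = - 1} = 1/2"
    and "f \<in> borel_measurable borel" "\<And>x. \<bar>f x\<bar> \<le> 1" and "k \<le> n"
  shows "expectation (\<lambda>\<omega>. f (\<Sum>i=1..k. X i \<omega> * a i)) = rad (rev (map a [1..<Suc k])) f"
  using assms(4-)
proof (induction k arbitrary: f)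
  case 0
  then show ?case by (simp add: prob_space)
next
  case (Suc k)
  define S where "S = (\<lambda>\<omega>. \<Sum>i=1..k. X i \<omega> * a i)"
  let ?Y = "X (Suc k)" and ?a = "a (Suc k)"
  note [measurable] = Suc.prems(1)
  have Xm: "X i \<in> borel_measurable M" if "i \<in> {1..n}" for i
    using indep that by (auto simp: indep_vars_def)
  have [measurable]: "?Y \<in> borel_measurable M" using Xm Suc.prems(3) by auto
  have [measurable]: "S \<in> borel_measurable M"
    unfolding S_def using Xm Suc.prems(3) by (intro borel_measurable_sum borel_measurable_times) auto
  have ind: "indep_var borel ?Y borel S"
  proof -
    \<comment> \<open>The weight of the last sign is set to 1 in order to express \<open>X (Suc k)\<close> itself and the sum of the others
      through one independent family.\<close>
    define c where "c i = (if i = Suc k then 1 else a i)" for i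
    have "indep_vars (\<lambda>_. borel) X (insert (Suc k) {1..k})"
      by (rule indep_vars_subset[OF indep]) (use Suc.prems(3) in auto)
    then have "indep_vars (\<lambda>_. borel) (\<lambda>i \<omega>. X i \<omega> * c i) (insert (Suc k) {1..k})"
      by (rule indep_vars_compose2[where Y = "\<lambda>i x. x * c i"]) auto
    then have "indep_var borel (\<lambda>\<omega>. X (Suc k) \<omega> * c (Suc k)) borel (\<lambda>\<omega>. \<Sum>i=1..k. X i \<omega> * c i)"
      by (intro indep_vars_sum) auto
    moreover have "(\<lambda>\<omega>. \<Sum>i=1..k. X i \<omega> * c i) = S"
      by (auto simp: S_def c_def fun_eq_iff intro!: sum.cong)
    ultimately show ?thesis by (simp add: c_def)
  qed
  have half: "expectation (\<lambda>\<omega>. indicator {e} (?Y \<omega>) * f (S \<omega> + t)) = 1/2 * expectation (\<lambda>\<omega>. f (S \<omega> + t))"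
    if e: "e = 1 \<or> e = - 1" for e t :: real
  proof -
    have "indep_var borel ((\<lambda>y. indicator {e} y :: real) \<circ> ?Y) borel ((\<lambda>s. f (s + t)) \<circ> S)"
      by (rule indep_var_compose[OF ind]) measurable
    then have "expectation (\<lambda>\<omega>. indicator {e} (?Y \<omega>) * f (S \<omega> + t))
      = expectation (\<lambda>\<omega>. indicator {e} (?Y \<omega>)) * expectation (\<lambda>\<omega>. f (S \<omega> + t))"
      unfolding o_def using Suc.prems(2)
      by (intro indep_var_lebesgue_integral integrable_const_bound[where B = 1])
         (auto simp: indicator_def)
    also have "expectation (\<lambda>\<omega>. indicator {e} (?Y \<omega>)) = prob {\<omega> \<in> space M. ?Y \<omega> = e}"
    proof -
      have "expectation (\<lambda>\<omega>. indicat_real {e} (?Y \<omega>)) = expectation (indicat_real {\<omega> \<in> space M. ?Y \<omega> = e})"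
        by (rule Bochner_Integration.integral_cong) (auto simp: indicator_def)
      then show ?thesis by simp
    qed
    also have "\<dots> = 1/2" using e plus[of "Suc k"] minus[of "Suc k"] Suc.prems(3) by auto
    finally show ?thesis .
  qed
  have ae: "AE \<omega> in M. ?Y \<omega> = 1 \<or> ?Y \<omega> = - 1"
  proof (rule AE_I_eq_1)
    have "prob ({\<omega> \<in> space M. ?Y \<omega> = 1} \<union> {\<omega> \<in> space M. ?Y \<omega> = - 1})
      = prob {\<omega> \<in> space M. ?Y \<omega> = 1} + prob {\<omega> \<in> space M. ?Y \<omega> = - 1}"
      by (intro finite_measure_Union) auto
    then have "prob {\<omega> \<in> space M. ?Y \<omega> = 1 \<or> ?Y \<omega> = - 1} = 1"
      using plus[of "Suc k"] minus[of "Suc k"] Suc.prems(3) by (simp add: Collect_conj_eq[symmetric] Un_def conj_disj_distribL)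
    then show "emeasure M {\<omega> \<in> space M. ?Y \<omega> = 1 \<or> ?Y \<omega> = - 1} = 1"
      by (simp add: emeasure_eq_measure)
  qed auto
  have sum: "(\<Sum>i=1..Suc k. X i \<omega> * a i) = S \<omega> + ?Y \<omega> * ?a" for \<omega>
    by (simp add: S_def)
  have "expectation (\<lambda>\<omega>. f (\<Sum>i=1..Suc k. X i \<omega> * a i))
    = expectation (\<lambda>\<omega>. indicator {1} (?Y \<omega>) * f (S \<omega> + ?a) + indicator {- 1} (?Y \<omega>) * f (S \<omega> + - ?a))"
  proof (rule integral_cong_AE)
    show "AE \<omega> in M. f (\<Sum>i=1..Suc k. X i \<omega> * a i)
      = indicator {1} (?Y \<omega>) * f (S \<omega> + ?a) + indicator {- 1} (?Y \<omega>) * f (S \<omega> + - ?a)"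
      unfolding sum using ae by eventually_elim (auto simp: indicator_def)
  qed (simp_all only: sum, measurable)
  also have "\<dots> = expectation (\<lambda>\<omega>. indicator {1} (?Y \<omega>) * f (S \<omega> + ?a))
      + expectation (\<lambda>\<omega>. indicator {- 1} (?Y \<omega>) * f (S \<omega> + - ?a))"
    using Suc.prems(2)
    by (intro Bochner_Integration.integral_add integrable_const_bound[where B = 1])
       (auto simp: indicator_def)
  also have "\<dots> = 1/2 * expectation (\<lambda>\<omega>. f (S \<omega> + ?a)) + 1/2 * expectation (\<lambda>\<omega>. f (S \<omega> + - ?a))"
    by (simp only: half simp_thms)
  also have "\<dots> = expectation (\<lambda>\<omega>. 1/2 * f (S \<omega> + ?a) + 1/2 * f (S \<omega> + - ?a))"
  proof -
    have "integrable M (\<lambda>\<omega>. 1/2 * f (S \<omega> + t))" for t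
    proof (intro integrable_mult_right integrable_const_bound[where B = 1])
      show "AE \<omega> in M. norm (f (S \<omega> + t)) \<le> 1" using Suc.prems(2) by simp
    qed measurable
    from Bochner_Integration.integral_add[OF this[of ?a] this[of "- ?a"]] show ?thesis
      by simp
  qed
  also have "\<dots> = expectation (\<lambda>\<omega>. avg ?a f (S \<omega>))"
    by (simp add: avg_def field_simps)
  also have "\<dots> = rad (rev (map a [1..<Suc k])) (avg ?a f)"
  unfolding S_def
  proof (rule Suc.IH)
    show "avg ?a f \<in> borel_measurable borel" unfolding avg_def by measurable
    show "\<bar>avg ?a f x\<bar> \<le> 1" for x
      using Suc.prems(2)[of "x + ?a"] Suc.prems(2)[of "x - ?a"] by (auto simp: avg_def abs_le_iff)
  qed (use Suc.prems in simp)
  finally show ?case by simp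
qed

theorem theorem1p1:
  fixes M :: "'w measure"
    and n :: nat
    and a :: "nat \<Rightarrow> real"
    and \<epsilon> :: "nat \<Rightarrow> 'w \<Rightarrow> real"
  assumes "prob_space M"
    and "(\<Sum>i=1..n. (a i)\<^sup>2) = 1"
    and "prob_space.indep_vars M (\<lambda>_. borel) \<epsilon> {1..n}"
    and "\<And>i. i \<in> {1..n} \<Longrightarrow> \<P>(\<omega> in M. \<epsilon> i \<omega> = 1) = 1/2"
    and "\<And>i. i \<in> {1..n} \<Longrightarrow> \<P>(\<omega> in M. \<epsilon> i \<omega> = -1) = 1/2"
  shows "\<P>(\<omega> in M. \<bar>\<Sum>i=1..n. \<epsilon> i \<omega> * a i\<bar> \<le> 1) \<ge> 0.46"
proof -
  interpret prob_space M by fact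
  let ?as = "rev (map a [1..<Suc n])" and ?S = "\<lambda>\<omega>. \<Sum>i=1..n. \<epsilon> i \<omega> * a i"
  have "ssq ?as = (\<Sum>x\<leftarrow>[1..<Suc n]. (a x)\<^sup>2)"
    by (simp only: rev_map map_map sum_list_rev o_def flip: rev_map)
  also have "\<dots> = (\<Sum>i=1..n. (a i)\<^sup>2)"
    unfolding interv_sum_list_conv_sum_set_nat by (rule sum.cong) auto
  finally have "ssq ?as = 1" using assms(2) by simp
  then have "0.46 \<le> rad ?as (ind 1)" by (rule rad_ge)
  also have "\<dots> = expectation (\<lambda>\<omega>. ind 1 (?S \<omega>))"
  proof (rule expectation_signed_sum[OF assms(3-5), symmetric])
    show "ind 1 \<in> borel_measurable borel" unfolding ind_def by measurable
    show "\<bar>ind 1 x\<bar> \<le> 1" for x by (simp add: ind_def)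
  qed simp_all
  also have "\<dots> = expectation (indicator {\<omega> \<in> space M. \<bar>?S \<omega>\<bar> \<le> 1})"
    by (rule Bochner_Integration.integral_cong) (auto simp: ind_def indicator_def)
  also have "\<dots> = prob {\<omega> \<in> space M. \<bar>?S \<omega>\<bar> \<le> 1}"
    by (simp add: Int_absorb2 subset_iff)
  finally show ?thesis .
qed

end
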